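(* Let $(I,g)$ be an $S$-unimodal system whose kneading sequence $\mathcal K(g)$ is preperiodic. Then $(I,g)$ is a factor of a finite automaton.
   Context: Unimodal systems. A dynamical system $(I,g)$ on a real interval $I=[a,b]$ is unimodal if $g$ is continuous, $g(a)=g(b)=a$, and there is a critical point $c\in(a,b)$ such that $g$ is (strictly) increasing on $[a,c]$ and (strictly) decreasing on $[c,b]$. It is $S$-unimodal if moreover $g$ has a continuous third derivative, $g''(c)<0$, and $Sg(x)<0$ for all $x\neq c$, where $Sg(x)=\frac{g'''(x)}{g'(x)}-\frac32\left(\frac{g''(x)}{g'(x)}\right)^2$. Kneading sequence. For $u\in\{0,1\}^{\mathbb N}$ put $\tau_n(u)=\sum_{i=0}^n u_i \bmod 2$. The itinerary $\mathcal I(x)\in\{0,1\}^{\mathbb N}$ of $x\in I$ is defined recursively by: $g^i(x)<c\Rightarrow\mathcal I(x)_i=0$; $g^i(x)>c\Rightarrow\mathcal I(x)_i=1$; $g^i(x)=c\Rightarrow\mathcal I(x)_i$ is chosen so that $\tau_i(\mathcal I(x))=0$. The kneading sequence is $\mathcal K(g)=\mathcal I(g(c))$. A sequence $u\in\{0,1\}^{\mathbb N}$ is periodic if $\sigma^n(u)=u$ for some $n>0$, where $\sigma(u)_i=u_{i+1}$; preperiodic if it is not periodic but $\sigma^i(u)$ is periodic for some $i\geq 0$. A dynamical system $(X,f)$ is a continuous map $f:X\to X$ of a compact metric space $X$ to itself. $(Y,g)$ is a factor of $(X,f)$ if there is a continuous surjective map $\varphi:X\to Y$ with $g\varphi=\varphi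 f$. Finite automata. For a finite alphabet $A$ let $A^{\mathbb N}$ be the set of infinite sequences $u=u_0u_1u_2\ldots$ with $u_i\in A$ and metric $2^{-n}$, $n=\inf\{i\ge 0: u_i\ne v_i\}$. Let $\bullet,\sharp$ be symbols not in the alphabets, and define on $A^{\mathbb N}$: $\sigma_\sharp(u_0u_1u_2\ldots)=u_1u_2u_3\ldots$, $\sigma_\bullet(u)=u$, and $\sigma_a(u_0u_1\ldots)=au_0u_1\ldots$ for $a\in A$. Let $T$ be a finite set (of tapes) and for each $t\in T$ let $A_t$ be a finite alphabet. Put $Q=\prod_{t\in T}A_t$, $X=\prod_{t\in T}A_t^{\mathbb N}$ with a product metric, and $\pi:X\to Q$, $\pi(u)_t=u_{t0}$. The automaton with transition functions $f_t:Q\to A_t\cup\{\bullet,\sharp\}$ $(t\in T)$ is the dynamical system $(X,f)$ with $f(u)_t=\sigma_{f_t(\pi(u))}(u_t)$ for $u\in X$, $t\in T$. A tape $t$ is an input tape if $f_t(q)\in\{\bullet,\sharp\}$ for all $q\in Q$, and an output tape if $f_t(q)\in A_t\cup\{\bullet\}$ for all $q\in Q$. The automaton is a finite automaton if every tape is an input tape or an output tape. *)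

theory Defs
  imports "HOL-Analysis.Analysis"
begin

section \<open>Dynamical systems and factors\<close>

definition dynamical_system :: "'a topology \<Rightarrow> ('a \<Rightarrow> 'a) \<Rightarrow> bool" where
  "dynamical_system X f \<longleftrightarrow>
     compact_space X \<and> metrizable_space X \<and> continuous_map X X f"

definition is_factor ::
  "'b topology \<Rightarrow> ('b \<Rightarrow> 'b) \<Rightarrow> 'a topology \<Rightarrow> ('a \<Rightarrow> 'a) \<Rightarrow> bool" where
  "is_factor Y g X f \<longleftrightarrow>
     dynamical_system X f \<and> dynamical_system Y g \<and>
     (\<exists>\<phi>. continuous_map X Y \<phi> \<and> \<phi> ` topspace X = topspace Y \<and>
          (\<forall>x\<in>topspace X. g (\<phi> x) = \<phi> (f x)))"


section \<open>Unimodal systems\<close>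

definition unimodal :: "real \<Rightarrow> real \<Rightarrow> (real \<Rightarrow> real) \<Rightarrow> real \<Rightarrow> bool" where
  "unimodal a b g c \<longleftrightarrow>
     continuous_on {a..b} g \<and> g ` {a..b} \<subseteq> {a..b} \<and> g a = a \<and> g b = a \<and>
     c \<in> {a<..<b} \<and> strict_mono_on {a..c} g \<and> strict_antimono_on {c..b} g"

text \<open>
  The arguments are the first, second and third derivative of the map. Where the
  first derivative vanishes, the value is 0 because division by 0 gives 0; the condition
  of a negative value therefore entails that the derivative does not vanish there.
\<close>

definition schwarzian ::
  "(real \<Rightarrow> real) \<Rightarrow> (real \<Rightarrow> real) \<Rightarrow> (real \<Rightarrow> real) \<Rightarrow> real \<Rightarrow> real" where
  "schwarzian g1 g2 g3 x = g3 x / g1 x - 3 / 2 * (g2 x / g1 x)\<^sup>2"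

text \<open>
  Derivatives are taken within the interval, hence one-sided at its end points; there they
  are uniquely determined by \<open>g\<close>.
\<close>

definition S_unimodal :: "real \<Rightarrow> real \<Rightarrow> (real \<Rightarrow> real) \<Rightarrow> real \<Rightarrow> bool" where
  "S_unimodal a b g c \<longleftrightarrow>
     unimodal a b g c \<and>
     (\<exists>g1 g2 g3.
        (\<forall>x\<in>{a..b}. (g has_real_derivative g1 x) (at x within {a..b})) \<and>
        (\<forall>x\<in>{a..b}. (g1 has_real_derivative g2 x) (at x within {a..b})) \<and>
        (\<forall>x\<in>{a..b}. (g2 has_real_derivative g3 x) (at x within {a..b})) \<and>
        continuous_on {a..b} g3 \<and>
        g2 c < 0 \<and>
        (\<forall>x\<in>{a..b}. x \<noteq> c \<longrightarrow> schwarzian g1 g2 g3 x < 0))"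


section \<open>Kneading sequences\<close>

definition tau :: "nat \<Rightarrow> (nat \<Rightarrow> nat) \<Rightarrow> nat" where
  "tau n u = (\<Sum>i\<le>n. u i) mod 2"

text \<open>
  If the \<open>i\<close>-th iterate is \<open>c\<close>, then the \<open>i\<close>-th symbol is the unique one which makes the parity
  \<open>tau i\<close> even, namely the parity of the preceding symbols; see \<open>itinerary_unique\<close> below.
\<close>

fun itinerary :: "(real \<Rightarrow> real) \<Rightarrow> real \<Rightarrow> real \<Rightarrow> nat \<Rightarrow> nat" where
  "itinerary g c x i =
     (if (g ^^ i) x < c then 0
      else if (g ^^ i) x > c then 1
      else (\<Sum>j<i. itinerary g c x j) mod 2)"

declare itinerary.simps [simp del]

lemma itinerary_le_1: "itinerary g c x i \<in> {0, 1}"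
  by (subst itinerary.simps) auto

lemma itinerary_below: "(g ^^ i) x < c \<Longrightarrow> itinerary g c x i = 0"
  by (subst itinerary.simps) auto

lemma itinerary_above: "(g ^^ i) x > c \<Longrightarrow> itinerary g c x i = 1"
  by (subst itinerary.simps) auto

lemma tau_split: "tau i u = ((\<Sum>j<i. u j) + u i) mod 2"
  by (simp add: tau_def flip: lessThan_Suc_atMost)

lemma itinerary_critical:
  assumes "(g ^^ i) x = c"
  shows "tau i (itinerary g c x) = 0"
proof -
  have "itinerary g c x i = (\<Sum>j<i. itinerary g c x j) mod 2"
    using assms by (subst itinerary.simps) auto
  then show ?thesis
    by (simp only: tau_split) presburger
qed

lemma itinerary_unique:
  assumes "\<And>i. u i \<in> {0, 1}"
    and "\<And>i. (g ^^ i) x < c \<Longrightarrow> u i = 0"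
    and "\<And>i. (g ^^ i) x > c \<Longrightarrow> u i = 1"
    and "\<And>i. (g ^^ i) x = c \<Longrightarrow> tau i u = 0"
  shows "u = itinerary g c x"
proof
  fix i
  show "u i = itinerary g c x i"
  proof (induction i rule: less_induct)
    case (less i)
    consider "(g ^^ i) x < c" | "(g ^^ i) x > c" | "(g ^^ i) x = c"
      by linarith
    then show ?case
    proof cases
      case 3
      have s: "(\<Sum>j<i. u j) = (\<Sum>j<i. itinerary g c x j)"
        using less by (intro sum.cong) auto
      have "((\<Sum>j<i. itinerary g c x j) + u i) mod 2 = 0"
        using assms(4)[OF 3] by (simp add: tau_split s)
      moreover have "((\<Sum>j<i. itinerary g c x j) + itinerary g c x i) mod 2 = 0"
        using itinerary_critical[OF 3] by (simp add: tau_split)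
      ultimately show ?thesis
        using assms(1)[of i] itinerary_le_1[of g c x i] by (auto; presburger)
    qed (use assms itinerary_below itinerary_above in auto)
  qed
qed

definition kneading :: "(real \<Rightarrow> real) \<Rightarrow> real \<Rightarrow> nat \<Rightarrow> nat" where
  "kneading g c = itinerary g c (g c)"

definition shift :: "(nat \<Rightarrow> 'a) \<Rightarrow> nat \<Rightarrow> 'a" where
  "shift u = (\<lambda>i. u (Suc i))"

definition periodic :: "(nat \<Rightarrow> 'a) \<Rightarrow> bool" where
  "periodic u \<longleftrightarrow> (\<exists>n>0. (shift ^^ n) u = u)"

definition preperiodic :: "(nat \<Rightarrow> 'a) \<Rightarrow> bool" where
  "preperiodic u \<longleftrightarrow> \<not> periodic u \<and> (\<exists>i. periodic ((shift ^^ i) u))"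


section \<open>Sequence spaces\<close>

definition seqs :: "'a set \<Rightarrow> (nat \<Rightarrow> 'a) set" where
  "seqs A = UNIV \<rightarrow> A"

definition seq_dist :: "(nat \<Rightarrow> 'a) \<Rightarrow> (nat \<Rightarrow> 'a) \<Rightarrow> real" where
  "seq_dist u v = (if u = v then 0 else (1 / 2) ^ (LEAST i. u i \<noteq> v i))"

lemma Metric_space_seqs: "Metric_space (seqs A) seq_dist"
proof
  fix u v w :: "nat \<Rightarrow> 'a"
  show "0 \<le> seq_dist u v"
    by (simp add: seq_dist_def)
  show "seq_dist u v = seq_dist v u"
    by (simp add: seq_dist_def eq_commute)
  show "seq_dist u v = 0 \<longleftrightarrow> u = v"
    by (simp add: seq_dist_def)
  show "seq_dist u w \<le> seq_dist u v + seq_dist v w"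
  proof (cases "u = v \<or> v = w \<or> u = w")
    case True
    then show ?thesis
      by (auto simp: seq_dist_def)
  next
    case False
    let ?n = "\<lambda>u v :: nat \<Rightarrow> 'a. LEAST i. u i \<noteq> v i"
    from False have "\<exists>i. u i \<noteq> w i"
      by auto
    then have "u (?n u w) \<noteq> w (?n u w)"
      by (rule LeastI_ex)
    then have "u (?n u w) \<noteq> v (?n u w) \<or> v (?n u w) \<noteq> w (?n u w)"
      by auto
    then have "?n u v \<le> ?n u w \<or> ?n v w \<le> ?n u w"
      by (meson Least_le)
    then have "(1 / 2 :: real) ^ ?n u w \<le> (1 / 2) ^ ?n u v \<or>
        (1 / 2 :: real) ^ ?n u w \<le> (1 / 2) ^ ?n v w"
      by (auto intro!: power_decreasing)
    moreover have "(0 :: real) \<le> (1 / 2) ^ ?n u v" "(0 :: real) \<le> (1 / 2) ^ ?n v w"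
      by simp_all
    ultimately show ?thesis
      using False unfolding seq_dist_def by (smt (verit))
  qed
qed

definition seq_topology :: "'a set \<Rightarrow> (nat \<Rightarrow> 'a) topology" where
  "seq_topology A = Metric_space.mtopology (seqs A) seq_dist"


section \<open>Automata\<close>

text \<open>
  \<open>Stay\<close> is the symbol \<open>\<bullet>\<close>, \<open>Shift\<close> is the symbol \<open>\<sharp>\<close>, and \<open>Push a\<close> is the letter \<open>a\<close>; as
  distinct constructors the two special symbols lie outside every alphabet.
\<close>

datatype 'a action = Stay | Shift | Push 'a

fun act :: "'a action \<Rightarrow> (nat \<Rightarrow> 'a) \<Rightarrow> nat \<Rightarrow> 'a" where
  "act Stay u = u"
| "act Shift u = shift u"
| "act (Push a) u = case_nat a u"

text \<open>
  \<open>T\<close> is the set of tapes, \<open>A t\<close> the alphabet of tape \<open>t\<close>, and \<open>F t\<close> its transition function.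
\<close>

definition states :: "'t set \<Rightarrow> ('t \<Rightarrow> 'a set) \<Rightarrow> ('t \<Rightarrow> 'a) set" where
  "states T A = (\<Pi>\<^sub>E t\<in>T. A t)"

definition automaton ::
  "'t set \<Rightarrow> ('t \<Rightarrow> 'a set) \<Rightarrow> ('t \<Rightarrow> ('t \<Rightarrow> 'a) \<Rightarrow> 'a action) \<Rightarrow> bool" where
  "automaton T A F \<longleftrightarrow>
     finite T \<and> (\<forall>t\<in>T. finite (A t)) \<and>
     (\<forall>t\<in>T. \<forall>q\<in>states T A. F t q \<in> Push ` A t \<union> {Stay, Shift})"

definition automaton_space :: "'t set \<Rightarrow> ('t \<Rightarrow> 'a set) \<Rightarrow> ('t \<Rightarrow> nat \<Rightarrow> 'a) topology" where
  "automaton_space T A = product_topology (\<lambda>t. seq_topology (A t)) T"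

definition current_state :: "'t set \<Rightarrow> ('t \<Rightarrow> nat \<Rightarrow> 'a) \<Rightarrow> 't \<Rightarrow> 'a" where
  "current_state T u = (\<lambda>t\<in>T. u t 0)"

definition automaton_map ::
  "'t set \<Rightarrow> ('t \<Rightarrow> ('t \<Rightarrow> 'a) \<Rightarrow> 'a action) \<Rightarrow> ('t \<Rightarrow> nat \<Rightarrow> 'a) \<Rightarrow> 't \<Rightarrow> nat \<Rightarrow> 'a" where
  "automaton_map T F u = (\<lambda>t\<in>T. act (F t (current_state T u)) (u t))"

definition input_tape ::
  "'t set \<Rightarrow> ('t \<Rightarrow> 'a set) \<Rightarrow> ('t \<Rightarrow> ('t \<Rightarrow> 'a) \<Rightarrow> 'a action) \<Rightarrow> 't \<Rightarrow> bool" where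
  "input_tape T A F t \<longleftrightarrow> (\<forall>q\<in>states T A. F t q \<in> {Stay, Shift})"

definition output_tape ::
  "'t set \<Rightarrow> ('t \<Rightarrow> 'a set) \<Rightarrow> ('t \<Rightarrow> ('t \<Rightarrow> 'a) \<Rightarrow> 'a action) \<Rightarrow> 't \<Rightarrow> bool" where
  "output_tape T A F t \<longleftrightarrow> (\<forall>q\<in>states T A. F t q \<in> Push ` A t \<union> {Stay})"

definition finite_automaton ::
  "'t set \<Rightarrow> ('t \<Rightarrow> 'a set) \<Rightarrow> ('t \<Rightarrow> ('t \<Rightarrow> 'a) \<Rightarrow> 'a action) \<Rightarrow> bool" where
  "finite_automaton T A F \<longleftrightarrow>
     automaton T A F \<and> (\<forall>t\<in>T. input_tape T A F t \<or> output_tape T A F t)"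

end

theory Submission
  imports Defs
begin

text \<open>
  A negative Schwarzian derivative makes \<open>g\<close> expand cross-ratios on either side of \<open>c\<close>. When the
  kneading sequence is preperiodic, \<open>c\<close> never returns to itself, and this expansion leaves only
  one kind of interval on which all iterates are monotone: those which end up in \<open>[a, r]\<close>, where
  \<open>r\<close> is the largest fixed point left of \<open>c\<close> and \<open>[a, r)\<close> is attracted to \<open>a\<close>. (The case
  \<open>a < r\<close> does occur, for instance with kneading sequence \<open>1000...\<close>; then itineraries do not
  separate points.) Hence either the orbit of \<open>c\<close> is finite, or \<open>g (g c) < r\<close>, and in both cases
  finitely many points form a Markov partition of the complement of a neighbourhood \<open>[a, y]\<close> of
  \<open>a\<close>. Paths through this partition determine points; they are produced by an output tape holding
  the current piece and an input tape choosing the next one. On \<open>[a, y]\<close> a point is an iterate of a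
  point of the fundamental domain \<open>[g y, y]\<close>, and the number of iterates is counted on a further
  output tape, which converges to a constant sequence as the orbit converges to \<open>a\<close>.
\<close>

section \<open>Automata as dynamical systems\<close>

text \<open>The map to be constructed must be single-valued and continuous, although neighbouring
  pieces share end points and the tapes carry discrete letters. It is therefore not given by a
  formula: each tape content \<open>u\<close> gets a set \<open>\<Psi> u\<close> of candidates, and
  its image is the unique point whose orbit stays in the candidate sets along the orbit of
  \<open>u\<close>. Existence is compactness, uniqueness is the separation of points by the sides of
  \<open>c\<close>, and continuity is the closedness of the graph. Sides cannot separate points of
  an attracting neighbourhood of \<open>a\<close>, whose orbits all stay left of \<open>c\<close>.
  There the candidate set is a single point computed from two tapes, and the partition covers only
  \<open>[y, b]\<close>. The cut at \<open>y\<close> also keeps the partition finite: if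
  \<open>g (g c) < r\<close>, the orbit of \<open>c\<close> may be infinite, but it matters only
  until it drops into \<open>[a, y]\<close>. An input tape is filled arbitrarily and can only be
  shifted, so illegal proposals for the next piece cannot be excluded; they are replaced by legal
  ones.\<close>

lemma topspace_seq_topology [simp]: "topspace (seq_topology A) = seqs A"
  unfolding seq_topology_def by (simp add: Metric_space.topspace_mtopology Metric_space_seqs)

lemma seq_dist_less_iff:
  "seq_dist u v < (1/2)^n \<longleftrightarrow> (\<forall>i\<le>n. u i = v i)"
proof (cases "u = v")
  case True
  then show ?thesis by (simp add: seq_dist_def)
next
  case False
  define k where "k = (LEAST i. u i \<noteq> v i)"
  from False have "\<exists>i. u i \<noteq> v i" by auto
  then have k: "u k \<noteq> v k" unfolding k_def by (rule LeastI_ex)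
  have k': "\<And>i. i < k \<Longrightarrow> u i = v i"
    unfolding k_def using not_less_Least by blast
  have "seq_dist u v < (1/2)^n \<longleftrightarrow> n < k"
    using False power_strict_decreasing_iff[of "1/2::real" k n]
    by (simp only: seq_dist_def k_def[symmetric] if_False)
  also have "\<dots> \<longleftrightarrow> (\<forall>i\<le>n. u i = v i)"
    using k k' by (metis leI le_less_trans)
  finally show ?thesis .
qed

text \<open>In this form compactness is Tychonoff's theorem, and continuity can be checked symbol by
  symbol.\<close>

lemma seq_topology_eq_product:
  "seq_topology A = product_topology (\<lambda>_. discrete_topology A) (UNIV :: nat set)"
proof -
  interpret Metric_space "seqs A" seq_dist
    by (rule Metric_space_seqs)
  have seqs: "seqs A = (\<Pi>\<^sub>E i\<in>UNIV. A)"
    by (auto simp: seqs_def PiE_def)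
  show ?thesis
    unfolding seq_topology_def topology_eq
  proof (intro allI iffI)
    fix S assume S: "openin mtopology S"
    show "openin (product_topology (\<lambda>_. discrete_topology A) (UNIV :: nat set)) S"
      unfolding openin_product_topology_alt
    proof
      fix u assume "u \<in> S"
      with S obtain r where r: "r > 0" "mball u r \<subseteq> S" and SA: "S \<subseteq> seqs A"
        unfolding openin_mtopology by blast
      obtain n where n: "(1/2::real)^n < r"
        using real_arch_pow_inv[OF r(1), of "1/2"] by auto
      define U where "U = (\<lambda>i. if i \<le> n then {u i} else A)"
      have uA: "u \<in> seqs A" using SA \<open>u \<in> S\<close> by auto
      have "finite {i \<in> UNIV. U i \<noteq> A}"
        by (rule finite_subset[of _ "{..n}"]) (auto simp: U_def)
      moreover have "Pi\<^sub>E UNIV U \<subseteq> S"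
      proof
        fix v assume "v \<in> Pi\<^sub>E UNIV U"
        then have v: "\<And>i. v i \<in> U i" by auto
        then have "\<forall>i\<le>n. u i = v i" by (metis U_def singletonD)
        then have "seq_dist u v < r"
          using n less_trans[of "seq_dist u v" "(1/2)^n" r] by (simp only: seq_dist_less_iff)
        moreover have "v \<in> seqs A"
          using v uA by (auto simp: seqs_def U_def Pi_iff split: if_splits) (metis singletonD)
        ultimately show "v \<in> S"
          using r(2) uA by auto
      qed
      moreover have "\<forall>i\<in>UNIV. openin (discrete_topology A) (U i)" "u \<in> Pi\<^sub>E UNIV U"
        using uA by (auto simp: U_def seqs_def)
      ultimately have "finite {i \<in> UNIV. U i \<noteq> topspace (discrete_topology A)} \<and>
          (\<forall>i\<in>UNIV. openin (discrete_topology A) (U i)) \<and> u \<in> Pi\<^sub>E UNIV U \<and> Pi\<^sub>E UNIV U \<subseteq> S"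
        by (simp only: topspace_discrete_topology)
      then show "\<exists>U. finite {i \<in> UNIV. U i \<noteq> topspace (discrete_topology A)} \<and>
          (\<forall>i\<in>UNIV. openin (discrete_topology A) (U i)) \<and> u \<in> Pi\<^sub>E UNIV U \<and> Pi\<^sub>E UNIV U \<subseteq> S"
        by (intro exI[of _ U])
    qed
  next
    fix S assume S: "openin (product_topology (\<lambda>_. discrete_topology A) (UNIV :: nat set)) S"
    have SA: "S \<subseteq> seqs A"
      using openin_subset[OF S] by (simp add: seqs)
    show "openin mtopology S"
      unfolding openin_mtopology
    proof (intro conjI SA allI impI)
      fix u assume u: "u \<in> S"
      with S obtain U where U: "finite {i::nat. U i \<noteq> A}" "\<And>i. U i \<subseteq> A" "u \<in> Pi\<^sub>E UNIV U"
          "Pi\<^sub>E UNIV U \<subseteq> S"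
        unfolding openin_product_topology_alt by (auto dest!: bspec)
      obtain n where n: "\<And>i. U i \<noteq> A \<Longrightarrow> i \<le> n"
        using U(1) by (metis (mono_tags) finite_nat_set_iff_bounded_le mem_Collect_eq)
      have "mball u ((1/2)^n) \<subseteq> S"
      proof
        fix v assume "v \<in> mball u ((1/2)^n)"
        then have v: "v \<in> seqs A" "\<forall>i\<le>n. u i = v i"
          by (auto simp: seq_dist_less_iff simp del: power_one_over power_divide)
        have "v i \<in> U i" for i
          using v U(3) n[of i] by (cases "i \<le> n") (auto simp: seqs_def PiE_iff Pi_iff, metis)
        then have "v \<in> Pi\<^sub>E UNIV U" by auto
        then show "v \<in> S" using U(4) by blast
      qed
      then show "\<exists>r>0. mball u r \<subseteq> S"
        by (intro exI[of _ "(1/2)^n"]) simp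
    qed
  qed
qed

lemma compact_seq_topology: "finite A \<Longrightarrow> compact_space (seq_topology A)"
  by (simp add: seq_topology_eq_product compact_space_product_topology compact_space_discrete_topology)

lemma metrizable_seq_topology: "metrizable_space (seq_topology A)"
  unfolding seq_topology_def
  by (simp add: Metric_space.metrizable_space_mtopology Metric_space_seqs)

lemma continuous_map_symbol:
  assumes "t \<in> T"
  shows "continuous_map (automaton_space T A) (discrete_topology (A t)) (\<lambda>u. u t i)"
proof -
  have "continuous_map (automaton_space T A) (seq_topology (A t)) (\<lambda>u. u t)"
    unfolding automaton_space_def
    using assms by (rule continuous_map_product_projection)
  moreover have "continuous_map (seq_topology (A t)) (discrete_topology (A t)) (\<lambda>v. v i)"
    unfolding seq_topology_eq_product by (rule continuous_map_product_projection) simp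
  ultimately show ?thesis
    using continuous_map_compose by (fastforce simp: o_def)
qed

lemma topspace_automaton_space: "topspace (automaton_space T A) = (\<Pi>\<^sub>E t\<in>T. seqs (A t))"
  by (simp add: automaton_space_def)

lemma openin_symbol:
  assumes "t \<in> T"
  shows "openin (automaton_space T A) {u \<in> topspace (automaton_space T A). P (u t i)}"
proof -
  have "openin (automaton_space T A)
      {u \<in> topspace (automaton_space T A). u t i \<in> {a \<in> A t. P a}}"
    by (rule openin_continuous_map_preimage[OF continuous_map_symbol[OF assms]]) auto
  moreover have "u t i \<in> A t" if "u \<in> topspace (automaton_space T A)" for u
    using that assms by (auto simp: topspace_automaton_space seqs_def PiE_iff Pi_iff)
  ultimately show ?thesis
    by (smt (verit, best) Collect_cong mem_Collect_eq)
qed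

lemma openin_prefix:
  assumes "t \<in> T"
  shows "openin (automaton_space T A) {u \<in> topspace (automaton_space T A). \<forall>i<n. P i (u t i)}"
proof (induction n)
  case (Suc n)
  have "{u \<in> topspace (automaton_space T A). \<forall>i<Suc n. P i (u t i)} =
     {u \<in> topspace (automaton_space T A). \<forall>i<n. P i (u t i)} \<inter>
     {u \<in> topspace (automaton_space T A). P n (u t n)}"
    by (auto simp: less_Suc_eq)
  then show ?case
    using openin_Int[OF Suc openin_symbol[OF assms]] by (simp only:)
qed simp

lemma current_state_in_states:
  "u \<in> topspace (automaton_space T A) \<Longrightarrow> current_state T u \<in> states T A"
  by (auto simp: topspace_automaton_space current_state_def states_def seqs_def PiE_iff Pi_iff)

lemma act_in_seqs:
  "\<lbrakk>x \<in> Push ` A \<union> {Stay, Shift}; v \<in> seqs A\<rbrakk> \<Longrightarrow> act x v \<in> seqs A"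
  by (auto simp: seqs_def shift_def Pi_iff split: nat.split)

text \<open>The bound \<open>Suc i\<close> is due to \<open>Shift\<close>, which reads one place
  ahead.\<close>

lemma act_cong:
  assumes "\<And>j. j \<le> Suc i \<Longrightarrow> v j = u j"
  shows "act x v i = act x u i"
  using assms by (cases x; cases i) (simp_all add: shift_def)

lemma openin_current_state:
  assumes "finite T"
  shows "openin (automaton_space T A)
    {u \<in> topspace (automaton_space T A). \<forall>t\<in>T. u t 0 = q t}"
proof -
  have "{u \<in> topspace (automaton_space T A). \<forall>t\<in>T. u t 0 = q t} =
      topspace (automaton_space T A) \<inter>
      (\<Inter>t\<in>T. {u \<in> topspace (automaton_space T A). u t 0 = q t})"
    by auto
  also have "openin (automaton_space T A) \<dots>"
  proof (cases "T = {}")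
    case False
    then show ?thesis
      using assms by (intro openin_Int openin_topspace openin_INT2 openin_symbol)
  qed auto
  finally show ?thesis .
qed

lemma dynamical_system_automaton:
  assumes "automaton T A F"
  shows "dynamical_system (automaton_space T A) (automaton_map T F)"
proof -
  let ?X = "automaton_space T A"
  have fin: "finite T" "\<And>t. t \<in> T \<Longrightarrow> finite (A t)"
    and F: "\<And>t q. \<lbrakk>t \<in> T; q \<in> states T A\<rbrakk> \<Longrightarrow> F t q \<in> Push ` A t \<union> {Stay, Shift}"
    using assms by (auto simp: automaton_def)
  have "compact_space ?X"
    unfolding automaton_space_def compact_space_product_topology
    using fin by (simp add: compact_seq_topology)
  moreover have "metrizable_space ?X"
    unfolding automaton_space_def metrizable_space_product_topology
    using fin(1) by (auto simp: metrizable_seq_topology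
        intro: countable_subset[of _ T] countable_finite)
  moreover have "continuous_map ?X ?X (automaton_map T F)"
    unfolding automaton_space_def
  proof (rule continuous_map_coordinatewise_then_product; fold automaton_space_def)
    fix t assume t: "t \<in> T"
    show "continuous_map ?X (seq_topology (A t)) (\<lambda>u. automaton_map T F u t)"
      unfolding seq_topology_eq_product
    proof (rule continuous_map_coordinatewise_then_product)
      fix i
      have mem: "automaton_map T F u t i \<in> A t" if "u \<in> topspace ?X" for u
      proof -
        have "act (F t (current_state T u)) (u t) \<in> seqs (A t)"
          using that t by (intro act_in_seqs F current_state_in_states)
            (auto simp: topspace_automaton_space)
        then show ?thesis
          using t by (auto simp: automaton_map_def seqs_def)
      qed
      have "openin ?X {u \<in> topspace ?X. automaton_map T F u t i \<in> U}" for U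
      proof (subst openin_subopen, safe)
        fix u assume u: "u \<in> topspace ?X" "automaton_map T F u t i \<in> U"
        \<comment> \<open>The first set freezes the state and hence the action on \<open>t\<close>;
          the second freezes the symbols up to \<open>Suc i\<close>, all that the action can
          read.\<close>
        define W where "W = {v \<in> topspace ?X. \<forall>s\<in>T. v s 0 = u s 0} \<inter>
            {v \<in> topspace ?X. \<forall>j<Suc (Suc i). v t j = u t j}"
        have "openin ?X W"
          unfolding W_def by (intro openin_Int openin_current_state[OF fin(1)] openin_prefix[OF t])
        moreover have "automaton_map T F v t i = automaton_map T F u t i" if "v \<in> W" for v
        proof -
          have "current_state T v = current_state T u"
            using that by (auto simp: W_def current_state_def)
          moreover have "v t j = u t j" if "j \<le> Suc i" for j
            using \<open>v \<in> W\<close> that unfolding W_def by (blast intro: le_imp_less_Suc)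
          then have "act x (v t) i = act x (u t) i" for x
            by (rule act_cong)
          ultimately show ?thesis
            unfolding automaton_map_def restrict_apply'[OF t] by (simp only:)
        qed
        then have "W \<subseteq> {u \<in> topspace ?X. automaton_map T F u t i \<in> U}"
          using u(2) unfolding W_def by fastforce
        ultimately show "\<exists>W. openin ?X W \<and> u \<in> W \<and>
            W \<subseteq> {u \<in> topspace ?X. automaton_map T F u t i \<in> U}"
          using u by (auto simp: W_def)
      qed
      then show "continuous_map ?X (discrete_topology (A t)) (\<lambda>u. automaton_map T F u t i)"
        unfolding continuous_map_def topspace_discrete_topology
        using mem by (intro conjI allI impI funcsetI)
    qed simp
  qed (simp add: automaton_map_def)
  ultimately show ?thesis
    by (simp add: dynamical_system_def)
qed

section \<open>Factor maps from set-valued tracking\<close>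

text \<open>The preimage of \<open>C\<close> is the projection of a closed part of the graph, and
  projecting along a compact factor is a closed map.\<close>

lemma continuous_map_from_closed_graph:
  assumes "compact_space Y" "\<phi> \<in> topspace X \<rightarrow> topspace Y"
    and "closedin (prod_topology X Y) {(u, x). u \<in> topspace X \<and> x = \<phi> u}"
  shows "continuous_map X Y \<phi>"
  unfolding continuous_map_closedin
proof (intro conjI ballI allI impI)
  fix C assume C: "closedin Y C"
  have "closedin (prod_topology X Y) ({(u, x). u \<in> topspace X \<and> x = \<phi> u} \<inter> topspace X \<times> C)"
    using assms(3) C by (intro closedin_Int) (auto simp: closedin_prod_Times_iff)
  then have "closedin X (fst ` ({(u, x). u \<in> topspace X \<and> x = \<phi> u} \<inter> topspace X \<times> C))"
    using closed_map_fst[OF assms(1), of X] by (auto simp: closed_map_def)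
  moreover have "fst ` ({(u, x). u \<in> topspace X \<and> x = \<phi> u} \<inter> topspace X \<times> C) =
      {u \<in> topspace X. \<phi> u \<in> C}"
    by force
  ultimately show "closedin X {u \<in> topspace X. \<phi> u \<in> C}" by simp
qed (use assms(2) in auto)

text \<open>The inclusion \<open>cover\<close> goes backwards: every candidate for
  \<open>f u\<close> has a preimage among the candidates for \<open>u\<close>. So finite orbit
  segments can be pulled back, and a nested intersection of compact sets gives a point that tracks
  \<open>u\<close> forever. The equation \<open>g (\<phi> u) = \<phi> (f u)\<close> then comes from
  uniqueness, because \<open>g (\<phi> u)\<close> tracks \<open>f u\<close>.\<close>

lemma is_factor_by_tracking:
  fixes K :: "'a :: heine_borel set" and \<Psi> :: "'b \<Rightarrow> 'a set"
  assumes f: "dynamical_system X f"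
    and K: "compact K" "continuous_on K g" "g ` K \<subseteq> K"
    and closed: "closedin (prod_topology X (top_of_set K)) {(u, x). u \<in> topspace X \<and> x \<in> \<Psi> u}"
    and nonempty: "\<And>u. u \<in> topspace X \<Longrightarrow> \<Psi> u \<noteq> {}"
    and cover: "\<And>u. u \<in> topspace X \<Longrightarrow> \<Psi> (f u) \<subseteq> g ` \<Psi> u"
    and unique: "\<And>u x y. \<lbrakk>u \<in> topspace X; x \<in> K; y \<in> K;
        \<And>n. (g ^^ n) x \<in> \<Psi> ((f ^^ n) u); \<And>n. (g ^^ n) y \<in> \<Psi> ((f ^^ n) u)\<rbrakk> \<Longrightarrow> x = y"
    and onto: "\<And>x. x \<in> K \<Longrightarrow> \<exists>u\<in>topspace X. \<forall>n. (g ^^ n) x \<in> \<Psi> ((f ^^ n) u)"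
  shows "is_factor (top_of_set K) g X f"
proof -
  let ?Y = "top_of_set K"
  define R where "R = {(u, x). u \<in> topspace X \<and> x \<in> \<Psi> u}"
  define S where "S = (\<lambda>N u. {x \<in> K. \<forall>n\<le>N. (g ^^ n) x \<in> \<Psi> ((f ^^ n) u)})"
  have contf: "continuous_map X X f"
    using f by (simp add: dynamical_system_def)
  have contg: "continuous_map ?Y ?Y g"
    using K by (simp add: image_subset_iff_funcset)
  have fX: "u \<in> topspace X \<Longrightarrow> (f ^^ n) u \<in> topspace X" for u n
    using contf by (induction n) (auto simp: continuous_map_def)
  have contgn: "continuous_map ?Y ?Y (g ^^ n)" for n
  proof (induction n)
    case (Suc n)
    then show ?case
      using continuous_map_compose[OF Suc contg] by (simp only: funpow.simps)
  qed (simp add: id_def)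
  have contfn: "continuous_map X X (f ^^ n)" for n
  proof (induction n)
    case (Suc n)
    then show ?case
      using continuous_map_compose[OF Suc contf] by (simp only: funpow.simps)
  qed (simp add: id_def)
  have closedR: "closedin (prod_topology X ?Y)
      {p \<in> topspace (prod_topology X ?Y). ((f ^^ n) (fst p), (g ^^ n) (snd p)) \<in> R}" for n
  proof (rule closedin_continuous_map_preimage)
    show "continuous_map (prod_topology X ?Y) (prod_topology X ?Y)
        (\<lambda>p. ((f ^^ n) (fst p), (g ^^ n) (snd p)))"
      unfolding continuous_map_paired
      using continuous_map_compose[OF continuous_map_fst[of X ?Y] contfn[of n]]
        continuous_map_compose[OF continuous_map_snd[of X ?Y] contgn[of n]]
      by (simp add: o_def del: continuous_map_subtopology_eu)
    show "closedin (prod_topology X ?Y) R"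
      using closed by (simp add: R_def)
  qed
  have \<Psi>K: "\<Psi> u \<subseteq> K" if "u \<in> topspace X" for u
    using closedin_subset[OF closed] that by auto
  have S_nonempty: "S N u \<noteq> {}" if "u \<in> topspace X" for N u
    using that
  proof (induction N arbitrary: u)
    case 0
    then show ?case using nonempty[OF 0] \<Psi>K[OF 0] by (auto simp: S_def)
  next
    case (Suc N)
    \<comment> \<open>The induction lengthens the segment at its beginning: a point tracking
      \<open>f u\<close> is pulled back into \<open>\<Psi> u\<close>.\<close>
    obtain z where z: "z \<in> S N (f u)"
      using Suc.IH[of "f u"] fX[OF Suc.prems, of 1] by auto
    then have "z \<in> \<Psi> (f u)" by (auto simp: S_def dest!: spec[of _ 0])
    then obtain x where x: "x \<in> \<Psi> u" "g x = z"
      using cover[OF Suc.prems] by auto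
    have "(g ^^ n) x \<in> \<Psi> ((f ^^ n) u)" if "n \<le> Suc N" for n
    proof (cases n)
      case (Suc m)
      then show ?thesis
        using z x that by (simp add: S_def funpow_swap1 del: funpow.simps)
          (simp add: funpow_Suc_right del: funpow.simps)
    qed (use x in auto)
    then show ?case using x \<Psi>K[OF Suc.prems] by (auto simp: S_def)
  qed
  have S_closed: "closedin ?Y (S N u)" if u: "u \<in> topspace X" for N u
  proof -
    have "closedin ?Y {x \<in> topspace ?Y. (g ^^ n) x \<in> \<Psi> ((f ^^ n) u)}" for n
    proof (rule closedin_continuous_map_preimage[OF contgn])
      have "continuous_map ?Y (prod_topology X ?Y) (\<lambda>x. ((f ^^ n) u, x))"
        unfolding continuous_map_paired
        using fX[OF u] continuous_map_id[of ?Y, unfolded id_def]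
        by (simp del: continuous_map_subtopology_eu)
      from closedin_continuous_map_preimage[OF this closed]
      have "closedin ?Y {x \<in> K. x \<in> \<Psi> ((f ^^ n) u)}"
        using fX[OF u] by simp
      moreover have "{x \<in> K. x \<in> \<Psi> ((f ^^ n) u)} = \<Psi> ((f ^^ n) u)"
        using \<Psi>K[OF fX[OF u]] by auto
      ultimately show "closedin ?Y (\<Psi> ((f ^^ n) u))" by simp
    qed
    then have "closedin ?Y (\<Inter>n\<in>{..N}. {x \<in> topspace ?Y. (g ^^ n) x \<in> \<Psi> ((f ^^ n) u)})"
      by (intro closedin_INT) auto
    moreover have "(\<Inter>n\<in>{..N}. {x \<in> topspace ?Y. (g ^^ n) x \<in> \<Psi> ((f ^^ n) u)}) = S N u"
      by (auto simp: S_def)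
    ultimately show ?thesis by simp
  qed
  have ex: "\<exists>x\<in>K. \<forall>n. (g ^^ n) x \<in> \<Psi> ((f ^^ n) u)" if u: "u \<in> topspace X" for u
  proof -
    have "(\<Inter>N. S N u) \<noteq> {}"
    proof (rule compact_nest)
      fix N
      show "compact (S N u)"
        using S_closed[OF u, of N] K(1) by (metis closedin_compact)
      show "S N u \<noteq> {}" by (rule S_nonempty[OF u])
    next
      fix m n :: nat assume "m \<le> n"
      then show "S n u \<subseteq> S m u" by (auto simp: S_def)
    qed
    then obtain x where "\<And>N. x \<in> S N u" by auto
    then show ?thesis by (auto simp: S_def)
  qed
  define \<phi> where "\<phi> = (\<lambda>u. SOME x. x \<in> K \<and> (\<forall>n. (g ^^ n) x \<in> \<Psi> ((f ^^ n) u)))"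
  have \<phi>: "\<phi> u \<in> K \<and> (\<forall>n. (g ^^ n) (\<phi> u) \<in> \<Psi> ((f ^^ n) u))" if "u \<in> topspace X" for u
    unfolding \<phi>_def by (rule someI_ex) (use ex[OF that] in auto)
  have \<phi>_eq: "x = \<phi> u" if "u \<in> topspace X" "x \<in> K" "\<And>n. (g ^^ n) x \<in> \<Psi> ((f ^^ n) u)" for u x
    using unique[OF that(1,2) _ that(3)] \<phi>[OF that(1)] by auto
  have "continuous_map X ?Y \<phi>"
  proof (rule continuous_map_from_closed_graph)
    show "compact_space ?Y" using K(1) by (simp add: compact_space_subtopology)
    show "\<phi> \<in> topspace X \<rightarrow> topspace ?Y" using \<phi> by auto
    have "closedin (prod_topology X ?Y) (\<Inter>n\<in>UNIV.
        {p \<in> topspace (prod_topology X ?Y). ((f ^^ n) (fst p), (g ^^ n) (snd p)) \<in> R})"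
      by (rule closedin_INT) (use closedR in auto)
    also have "(\<Inter>n\<in>UNIV.
        {p \<in> topspace (prod_topology X ?Y). ((f ^^ n) (fst p), (g ^^ n) (snd p)) \<in> R}) =
        {(u, x). u \<in> topspace X \<and> x = \<phi> u}"
      using \<phi> \<phi>_eq fX by (auto simp: R_def)
    finally show "closedin (prod_topology X ?Y) {(u, x). u \<in> topspace X \<and> x = \<phi> u}" .
  qed
  moreover have "\<phi> ` topspace X = K"
    using \<phi> onto \<phi>_eq by (force simp: image_iff)
  moreover have "g (\<phi> u) = \<phi> (f u)" if u: "u \<in> topspace X" for u
  proof (rule \<phi>_eq)
    show "f u \<in> topspace X" using fX[OF u, of 1] by simp
    show "g (\<phi> u) \<in> K" using \<phi>[OF u] K(3) by auto
    fix n
    show "(g ^^ n) (g (\<phi> u)) \<in> \<Psi> ((f ^^ n) (f u))"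
      using \<phi>[OF u] by (metis comp_apply funpow_Suc_right)
  qed
  moreover have "dynamical_system ?Y g"
    using K contg
    by (auto simp: dynamical_system_def compact_space_subtopology metrizable_space_subtopology
        metrizable_space_euclidean)
  ultimately show ?thesis
    using f by (auto simp: is_factor_def simp del: continuous_map_subtopology_eu)
qed

section \<open>Expansion of cross-ratios\<close>

definition cross_ratio :: "real \<Rightarrow> real \<Rightarrow> real \<Rightarrow> real \<Rightarrow> real" where
  "cross_ratio p u v q = (q - p) * (v - u) / ((u - p) * (q - v))"

lemma cross_ratio_rev: "cross_ratio q v u p = cross_ratio p u v q"
proof -
  have "(p - q) * (u - v) = (q - p) * (v - u)" "(v - q) * (p - u) = (u - p) * (q - v)"
    by algebra+
  then show ?thesis by (simp add: cross_ratio_def)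
qed

lemma cross_ratio_minus: "cross_ratio (- p) (- u) (- v) (- q) = cross_ratio p u v q"
proof -
  have "(- q - - p) * (- v - - u) = (q - p) * (v - u)"
       "(- u - - p) * (- q - - v) = (u - p) * (q - v)"
    by algebra+
  then show ?thesis by (simp only: cross_ratio_def)
qed

text \<open>The cross-ratio depends only on the ratios of the middle interval to its two neighbours,
  and increases with both. All comparisons of cross-ratios below use this form.\<close>

lemma cross_ratio_eq:
  assumes "p < u" "v < q"
  shows "cross_ratio p u v q = (1 + (v - u) / (u - p)) * (1 + (v - u) / (q - v)) - 1"
proof -
  define L R where "L = u - p" and "R = q - v"
  have "L \<noteq> 0" "R \<noteq> 0" using assms by (auto simp: L_def R_def)
  moreover have "q - p = L + (v - u) + R" by (simp add: L_def R_def)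
  ultimately show ?thesis
    unfolding cross_ratio_def L_def[symmetric] R_def[symmetric] by (simp add: divide_simps) (simp add: algebra_simps)
qed

lemma strictly_below_chord:
  fixes f :: "real \<Rightarrow> real"
  assumes "u < v" "v < w"
    and f: "\<And>x. \<lbrakk>u \<le> x; x \<le> w\<rbrakk> \<Longrightarrow> (f has_real_derivative f1 x) (at x)"
    and f1: "\<And>x. \<lbrakk>u \<le> x; x \<le> w\<rbrakk> \<Longrightarrow> (f1 has_real_derivative f2 x) (at x)"
    and f2: "\<And>x. \<lbrakk>u \<le> x; x \<le> w\<rbrakk> \<Longrightarrow> f2 x > 0"
  shows "f v * (w - u) < f u * (w - v) + f w * (v - u)"
proof -
  obtain z where z: "u < z" "z < v" "f v - f u = (v - u) * f1 z"
    using MVT2[OF \<open>u < v\<close>, of f f1] f assms(2) by auto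
  obtain y where y: "v < y" "y < w" "f w - f v = (w - v) * f1 y"
    using MVT2[OF \<open>v < w\<close>, of f f1] f assms(1) by auto
  have "f1 z < f1 y"
  proof (rule DERIV_pos_imp_increasing[of z y f1])
    fix x assume "z \<le> x" "x \<le> y"
    then have "u \<le> x" "x \<le> w" using y z by auto
    then show "\<exists>d. (f1 has_real_derivative d) (at x) \<and> 0 < d" using f1 f2 by blast
  qed (use y z in auto)
  then have "(v - u) * (w - v) * f1 z < (v - u) * (w - v) * f1 y"
    using assms by simp
  moreover have "f v * (w - v) = f u * (w - v) + (v - u) * (w - v) * f1 z"
    using z(3) by algebra
  moreover have "f v * (v - u) = f w * (v - u) - (v - u) * (w - v) * f1 y"
    using y(3) by algebra
  moreover have "f v * (w - u) = f v * (w - v) + f v * (v - u)"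
    by (simp add: algebra_simps)
  ultimately show ?thesis by linarith
qed

text \<open>This Moebius map is the primitive of \<open>1 / (l x)^2\<close> that vanishes at
  \<open>w\<close>, written so that a constant \<open>l\<close> is no exception.\<close>

lemma has_derivative_moebius:
  fixes l :: "real \<Rightarrow> real"
  assumes l: "\<And>x. l x = \<alpha> + s * x" and "l w \<noteq> 0" "l x \<noteq> 0"
  shows "((\<lambda>x. (x - w) / (l w * l x)) has_real_derivative 1 / (l x)\<^sup>2) (at x)"
proof -
  have "((\<lambda>x. (x - w) / (l w * (\<alpha> + s * x))) has_real_derivative
     (1 * (l w * (\<alpha> + s * x)) - (x - w) * (l w * s)) / (l w * (\<alpha> + s * x))\<^sup>2) (at x)"
    using assms(2,3) by (auto intro!: derivative_eq_intros simp: l[of x] power2_eq_square)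
  moreover have "1 * (l w * (\<alpha> + s * x)) - (x - w) * (l w * s) = (l w)\<^sup>2"
    by (simp add: l[of w] power2_eq_square algebra_simps)
  ultimately show ?thesis
    using assms(2,3) by (simp add: l[of x, symmetric] l[symmetric] power_mult_distrib)
qed

text \<open>
  A negative Schwarzian derivative makes \<open>G'\<^sup>-\<^sup>1\<^sup>/\<^sup>2\<close> strictly convex. Comparing it with
  its chord \<open>l\<close> over \<open>[u, v]\<close> compares \<open>G\<close> with a primitive of \<open>l\<^sup>-\<^sup>2\<close>, a Moebius map, which
  preserves cross-ratios.
\<close>

lemma cross_ratio_expand:
  assumes order: "p < u" "u < v" "v < q"
    and cont: "continuous_on {p..q} G"
    and G: "\<And>x. \<lbrakk>p < x; x < q\<rbrakk> \<Longrightarrow> (G has_real_derivative G1 x) (at x)"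
    and G1: "\<And>x. \<lbrakk>p < x; x < q\<rbrakk> \<Longrightarrow> (G1 has_real_derivative G2 x) (at x)"
    and G2: "\<And>x. \<lbrakk>p < x; x < q\<rbrakk> \<Longrightarrow> (G2 has_real_derivative G3 x) (at x)"
    and pos: "\<And>x. \<lbrakk>p < x; x < q\<rbrakk> \<Longrightarrow> G1 x > 0"
    and schw: "\<And>x. \<lbrakk>p < x; x < q\<rbrakk> \<Longrightarrow> schwarzian G1 G2 G3 x < 0"
  shows "cross_ratio p u v q < cross_ratio (G p) (G u) (G v) (G q)"
proof -
  define f where "f = (\<lambda>x. 1 / sqrt (G1 x))"
  define f1 where "f1 = (\<lambda>x. - G2 x / (2 * G1 x * sqrt (G1 x)))"
  \<comment> \<open>The classical identity \<open>f'' = - (1/2) * S * f\<close> for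
    \<open>f = 1 / sqrt G'\<close>, with \<open>S\<close> the Schwarzian derivative.\<close>
  define f2 where "f2 = (\<lambda>x. - (1/2) * schwarzian G1 G2 G3 x / sqrt (G1 x))"
  have f: "(f has_real_derivative f1 x) (at x)" if "p < x" "x < q" for x
    unfolding f_def f1_def
    by (rule derivative_eq_intros refl G1 pos that | use pos[OF that] in \<open>simp add: field_simps\<close>)+
  have f1: "(f1 has_real_derivative f2 x) (at x)" if "p < x" "x < q" for x
  proof -
    define s where "s = sqrt (G1 x)"
    have s: "s > 0" "G1 x = s\<^sup>2" using pos[OF that] by (auto simp: s_def)
    have "((\<lambda>x. - G2 x / (2 * G1 x * sqrt (G1 x))) has_real_derivative
       ((- G3 x) * (2 * G1 x * s) - (- G2 x) * (2 * G2 x * s + 2 * G1 x * (G2 x / (2 * s)))) /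
         (2 * G1 x * s)\<^sup>2) (at x)"
      by (rule derivative_eq_intros refl G1 G2 pos that
          | use pos[OF that] in \<open>simp add: s_def power2_eq_square field_simps\<close>)+
    also have "((- G3 x) * (2 * G1 x * s) - (- G2 x) * (2 * G2 x * s + 2 * G1 x * (G2 x / (2 * s)))) /
         (2 * G1 x * s)\<^sup>2 = f2 x"
      unfolding f2_def schwarzian_def s_def[symmetric] s(2) using s(1)
      by (simp add: field_simps power2_eq_square)
    finally show ?thesis by (simp add: f1_def)
  qed
  have f2: "f2 x > 0" if "p < x" "x < q" for x
    unfolding f2_def using schw[OF that] pos[OF that] by (simp add: field_simps)
  have fpos: "f x > 0" if "p < x" "x < q" for x
    using pos[OF that] by (simp add: f_def)
  have fG: "G1 x = 1 / (f x)\<^sup>2" if "p < x" "x < q" for x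
    using pos[OF that] by (simp add: f_def power_divide)
  have chord: "f y * (z - x) < f x * (z - y) + f z * (y - x)"
    if "p < x" "x < y" "y < z" "z < q" for x y z
    by (rule strictly_below_chord[of x y z f f1 f2]) (use that f f1 f2 in auto)

  define s where "s = (f v - f u) / (v - u)"
  define \<alpha> where "\<alpha> = f u - s * u"
  define l where "l = (\<lambda>x. \<alpha> + s * x)"
  have l: "\<And>x. l x = \<alpha> + s * x" by (simp add: l_def)
  have lx: "l x * (v - u) = f u * (v - x) + f v * (x - u)" for x
  proof -
    have "s * (v - u) = f v - f u" using order by (simp add: s_def)
    moreover have "l x * (v - u) = f u * (v - u) + s * (v - u) * (x - u)"
      by (simp add: l_def \<alpha>_def algebra_simps)
    ultimately show ?thesis by algebra
  qed
  have lu: "l u = f u" using lx[of u] order by simp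
  have lv: "l v = f v" using lx[of v] order by simp
  have inside: "f x < l x" if "u < x" "x < v" for x
    using chord[of u x v] lx[of x] that order by (smt (verit) mult_less_cancel_right_disj)
  have left: "l x < f x" if "p < x" "x < u" for x
  proof -
    have "l x * (v - u) < f x * (v - u)"
      using chord[of x u v] lx[of x] that order by (simp add: algebra_simps)
    then show ?thesis using order by simp
  qed
  have right: "l x < f x" if "v < x" "x < q" for x
  proof -
    have "l x * (v - u) < f x * (v - u)"
      using chord[of u v x] lx[of x] that order by (simp add: algebra_simps)
    then show ?thesis using order by simp
  qed
  have lupos: "l u > 0" and lvpos: "l v > 0"
    using lu lv fpos order by auto
  have mono_pos: "l x > 0" if "l x1 > 0" "l x2 > 0" "x1 \<le> x" "x \<le> x2" for x x1 x2
    using that unfolding l_def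
    by (smt (verit, best) mult_left_mono mult_left_mono_neg)
  \<comment> \<open>The difference of \<open>G\<close> and the Moebius map based at
    \<open>w\<close>. Where \<open>l > 0\<close>, it increases if \<open>f < l\<close>, that is
    inside \<open>(u, v)\<close>, and decreases if \<open>l < f\<close>, that is outside.\<close>
  define D where "D = (\<lambda>w x. G x - (x - w) / (l w * l x))"
  have dD: "(D w has_real_derivative 1 / (f x)\<^sup>2 - 1 / (l x)\<^sup>2) (at x)"
    if "p < x" "x < q" "l w > 0" "l x > 0" for x w
    unfolding D_def
    by (rule DERIV_diff) (use that G[OF that(1,2)] fG has_derivative_moebius[of l, OF l] in auto)
  have cD: "continuous_on S (D w)" if "S \<subseteq> {p..q}" "l w > 0" "\<And>x. x \<in> S \<Longrightarrow> l x > 0" for S w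
    unfolding D_def
    by (intro continuous_intros continuous_on_subset[OF cont that(1)])
      (use that in \<open>force simp: l_def intro!: continuous_intros\<close>)+

  have inc: "G x < G y" if "p \<le> x" "x < y" "y \<le> q" for x y
  proof (rule DERIV_pos_imp_increasing_open[OF that(2)])
    fix z assume "x < z" "z < y"
    then have "p < z" "z < q" using that by auto
    then show "\<exists>d. (G has_real_derivative d) (at z) \<and> 0 < d" using G pos by blast
  qed (use that in \<open>auto intro: continuous_on_subset[OF cont]\<close>)
  have J: "(v - u) / (l u * l v) < G v - G u"
  proof -
    have "D u u < D u v"
    proof (rule DERIV_pos_imp_increasing_open[OF \<open>u < v\<close>])
      fix x assume x: "u < x" "x < v"
      have "0 < f x" "f x < l x" using fpos inside x order by auto
      then have "1 / (l x)\<^sup>2 < 1 / (f x)\<^sup>2"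
        by (intro divide_strict_left_mono power_strict_mono mult_pos_pos) auto
      moreover have "(D u has_real_derivative 1 / (f x)\<^sup>2 - 1 / (l x)\<^sup>2) (at x)"
        by (rule dD) (use x order lupos \<open>0 < f x\<close> \<open>f x < l x\<close> in auto)
      ultimately show "\<exists>y. (D u has_real_derivative y) (at x) \<and> 0 < y"
        by (intro exI conjI) auto
    next
      show "continuous_on {u..v} (D u)"
        by (rule cD) (use order lupos in \<open>auto intro: mono_pos[OF lupos lvpos]\<close>)
    qed
    then show ?thesis by (simp add: D_def)
  qed
  have L: "(v - u) / (u - p) * (l p / l v) < (G v - G u) / (G u - G p)"
  proof (cases "l p > 0")
    case True
    have "D u u < D u p"
    proof (rule DERIV_neg_imp_decreasing_open[OF \<open>p < u\<close>])
      fix x assume x: "p < x" "x < u"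
      have lpos: "0 < l x" using mono_pos[OF True lupos] x by simp
      have "l x < f x" using left x order by auto
      then have "1 / (l x)\<^sup>2 > 1 / (f x)\<^sup>2"
        using lpos by (intro divide_strict_left_mono power_strict_mono mult_pos_pos) auto
      moreover have "(D u has_real_derivative 1 / (f x)\<^sup>2 - 1 / (l x)\<^sup>2) (at x)"
        by (rule dD) (use x order lupos lpos in auto)
      ultimately show "\<exists>y. (D u has_real_derivative y) (at x) \<and> y < 0"
        by (intro exI conjI) auto
    next
      show "continuous_on {p..u} (D u)"
        by (rule cD) (use order lupos in \<open>auto intro: mono_pos[OF True lupos]\<close>)
    qed
    then have "G u - G p < (u - p) / (l u * l p)"
      using minus_divide_left[of "p - u" "l u * l p"] by (simp add: D_def)
    moreover have "0 < G u - G p" using inc order by simp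
    ultimately have "((v - u) / (l u * l v)) / ((u - p) / (l u * l p)) < (G v - G u) / (G u - G p)"
      using J order lupos lvpos True by (intro frac_less) auto
    moreover have "((v - u) / (l u * l v)) / ((u - p) / (l u * l p)) =
        (v - u) / (u - p) * (l p / l v)"
      using lupos by simp
    ultimately show ?thesis by simp
  next
    case False
    then have "(v - u) / (u - p) * (l p / l v) \<le> 0"
      using order lvpos by (intro mult_nonneg_nonpos divide_nonpos_pos) auto
    moreover have "0 < (G v - G u) / (G u - G p)"
      using inc order by simp
    ultimately show ?thesis by linarith
  qed
  have R: "(v - u) / (q - v) * (l q / l u) < (G v - G u) / (G q - G v)"
  proof (cases "l q > 0")
    case True
    have "D v q < D v v"
    proof (rule DERIV_neg_imp_decreasing_open[OF \<open>v < q\<close>])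
      fix x assume x: "v < x" "x < q"
      have lpos: "0 < l x" using mono_pos[OF lvpos True] x by simp
      have "l x < f x" using right x order by auto
      then have "1 / (l x)\<^sup>2 > 1 / (f x)\<^sup>2"
        using lpos by (intro divide_strict_left_mono power_strict_mono mult_pos_pos) auto
      moreover have "(D v has_real_derivative 1 / (f x)\<^sup>2 - 1 / (l x)\<^sup>2) (at x)"
        by (rule dD) (use x order lvpos lpos in auto)
      ultimately show "\<exists>y. (D v has_real_derivative y) (at x) \<and> y < 0"
        by (intro exI conjI) auto
    next
      show "continuous_on {v..q} (D v)"
        by (rule cD) (use order lvpos in \<open>auto intro: mono_pos[OF lvpos True]\<close>)
    qed
    then have "G q - G v < (q - v) / (l v * l q)"
      by (simp add: D_def field_simps)
    moreover have "0 < G q - G v" using inc order by simp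
    ultimately have "((v - u) / (l u * l v)) / ((q - v) / (l v * l q)) < (G v - G u) / (G q - G v)"
      using J order lupos lvpos True by (intro frac_less) auto
    moreover have "((v - u) / (l u * l v)) / ((q - v) / (l v * l q)) =
        (v - u) / (q - v) * (l q / l u)"
      using lvpos by simp
    ultimately show ?thesis by simp
  next
    case False
    then have "(v - u) / (q - v) * (l q / l u) \<le> 0"
      using order lupos by (intro mult_nonneg_nonpos divide_nonpos_pos) auto
    moreover have "0 < (G v - G u) / (G q - G v)"
      using inc order by simp
    ultimately show ?thesis by linarith
  qed
  \<comment> \<open>In the product of this factor with its counterpart for \<open>q\<close> the
    chord values \<open>l u\<close> and \<open>l v\<close> cancel, which is the invariance of the
    cross-ratio under the Moebius map.\<close>
  have eL: "1 + (v - u) / (u - p) * (l p / l v) = (v - p) * l u / ((u - p) * l v)"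
    using order lvpos by (simp add: field_simps) (simp add: l_def algebra_simps)
  have eR: "1 + (v - u) / (q - v) * (l q / l u) = (q - u) * l v / ((q - v) * l u)"
    using order lupos by (simp add: field_simps) (simp add: l_def algebra_simps)
  have "cross_ratio p u v q = (v - p) * l u / ((u - p) * l v) * ((q - u) * l v / ((q - v) * l u)) - 1"
  proof -
    have "1 + (v - u) / (u - p) = (v - p) / (u - p)" "1 + (v - u) / (q - v) = (q - u) / (q - v)"
      using order by (auto simp: field_simps)
    moreover have "(v - p) * l u / ((u - p) * l v) * ((q - u) * l v / ((q - v) * l u)) =
        (v - p) / (u - p) * ((q - u) / (q - v))"
      using lupos lvpos by simp
    ultimately show ?thesis
      using cross_ratio_eq[OF order(1,3)] by simp
  qed
  also have "\<dots> < (1 + (G v - G u) / (G u - G p)) * (1 + (G v - G u) / (G q - G v)) - 1"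
  proof -
    have "0 < (v - p) * l u / ((u - p) * l v)" "0 < (q - u) * l v / ((q - v) * l u)"
      using order lupos lvpos by auto
    then show ?thesis
      using L R unfolding eL[symmetric] eR[symmetric]
      by (intro diff_strict_right_mono mult_strict_mono) auto
  qed
  also have "\<dots> = cross_ratio (G p) (G u) (G v) (G q)"
    using inc order by (intro cross_ratio_eq[symmetric]) auto
  finally show ?thesis .
qed

text \<open>The point \<open>c\<close> lies outside the open interval, so the negative Schwarzian
  forces \<open>g1\<close> to be nonzero there, and monotonicity of \<open>g\<close> fixes its sign.
  Right of \<open>c\<close> the map is replaced by \<open>- g\<close>, which has the same Schwarzian
  and the same cross-ratios.\<close>

lemma S_unimodal_cross_ratio:
  assumes S: "S_unimodal a b g c"
    and order: "a \<le> p" "p < u" "u < v" "v < q" "q \<le> b" and side: "q \<le> c \<or> c \<le> p"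
  shows "cross_ratio p u v q < cross_ratio (g p) (g u) (g v) (g q)"
proof -
  obtain g1 g2 g3 where
    d1: "\<And>x. x \<in> {a..b} \<Longrightarrow> (g has_real_derivative g1 x) (at x within {a..b})" and
    d2: "\<And>x. x \<in> {a..b} \<Longrightarrow> (g1 has_real_derivative g2 x) (at x within {a..b})" and
    d3: "\<And>x. x \<in> {a..b} \<Longrightarrow> (g2 has_real_derivative g3 x) (at x within {a..b})" and
    sch: "\<And>x. \<lbrakk>x \<in> {a..b}; x \<noteq> c\<rbrakk> \<Longrightarrow> schwarzian g1 g2 g3 x < 0"
    using S unfolding S_unimodal_def by blast
  have uni: "continuous_on {a..b} g" "strict_mono_on {a..c} g" "strict_antimono_on {c..b} g"
      "a < c" "c < b"
    using S by (auto simp: S_unimodal_def unimodal_def)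
  have within: "at x within {a..b} = at x" if "p < x" "x < q" for x
    using that order by (intro at_within_Icc_at) auto
  have D: "(g has_real_derivative g1 x) (at x)" "(g1 has_real_derivative g2 x) (at x)"
      "(g2 has_real_derivative g3 x) (at x)" "schwarzian g1 g2 g3 x < 0" "g1 x \<noteq> 0"
    if "p < x" "x < q" for x
  proof -
    have x: "x \<in> {a..b}" "x \<noteq> c" using that order side by auto
    show "schwarzian g1 g2 g3 x < 0" by (rule sch[OF x])
    then show "g1 x \<noteq> 0" by (auto simp: schwarzian_def)
    show "(g has_real_derivative g1 x) (at x)" "(g1 has_real_derivative g2 x) (at x)"
        "(g2 has_real_derivative g3 x) (at x)"
      using d1[OF x(1)] d2[OF x(1)] d3[OF x(1)] unfolding within[OF that] by auto
  qed
  have cont: "continuous_on {p..q} g"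
    using order by (intro continuous_on_subset[OF uni(1)]) auto
  from side show ?thesis
  proof
    assume "q \<le> c"
    have "0 < g1 x" if "p < x" "x < q" for x
    proof -
      have "mono_on {p..q} g"
        using strict_mono_on_imp_mono_on[OF uni(2)] order \<open>q \<le> c\<close>
        by (auto intro: mono_on_subset)
      then have "0 \<le> g1 x"
        by (rule mono_on_imp_deriv_nonneg[OF _ D(1)[OF that]]) (use that in auto)
      then show ?thesis using D(5)[OF that] by simp
    qed
    then show ?thesis
      by (intro cross_ratio_expand[OF order(2-4) cont, of g1 g2 g3] D)
  next
    assume "c \<le> p"
    have neg: "0 < - g1 x" if "p < x" "x < q" for x
    proof -
      have "mono_on {p..q} (\<lambda>x. - g x)"
      proof (rule mono_onI)
        fix x y assume "x \<in> {p..q}" "y \<in> {p..q}" "x \<le> y"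
        then show "- g x \<le> - g y"
          using monotone_onD[OF uni(3), of x y] order \<open>c \<le> p\<close> by (cases "x = y") auto
      qed
      then have "0 \<le> - g1 x"
        by (rule mono_on_imp_deriv_nonneg[OF _ DERIV_minus[OF D(1)[OF that]]]) (use that in auto)
      then show ?thesis using D(5)[OF that] by simp
    qed
    have "schwarzian (\<lambda>x. - g1 x) (\<lambda>x. - g2 x) (\<lambda>x. - g3 x) x = schwarzian g1 g2 g3 x" for x
      by (simp add: schwarzian_def)
    then have "cross_ratio p u v q < cross_ratio (- g p) (- g u) (- g v) (- g q)"
      by (intro cross_ratio_expand[OF order(2-4), of "\<lambda>x. - g x" "\<lambda>x. - g1 x" "\<lambda>x. - g2 x"
            "\<lambda>x. - g3 x"] DERIV_minus D neg continuous_on_minus cont) (simp_all add: D(4))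
    then show ?thesis by (simp add: cross_ratio_minus)
  qed
qed

section \<open>Unimodal maps with preperiodic kneading sequence\<close>

lemma funpow_shift: "(shift ^^ n) u i = u (i + n)"
  by (induction n arbitrary: u) (simp_all add: funpow_Suc_right shift_def del: funpow.simps(2))

text \<open>With \<open>s i\<close> meaning that the i-th iterate is right of \<open>c\<close>, this
  tells whether the branch of \<open>g^n\<close> along \<open>s\<close> is increasing.\<close>

fun orientation :: "(nat \<Rightarrow> bool) \<Rightarrow> nat \<Rightarrow> bool" where
  "orientation s 0 = True"
| "orientation s (Suc n) = (orientation s n \<noteq> s n)"

lemma orientation_add:
  "orientation s (m + n) = (orientation s m = orientation (\<lambda>i. s (i + m)) n)"
  by (induction n) (auto simp: add.commute)

text \<open>The strict expansion of cross-ratios is all that is used of the Schwarzian derivative.\<close>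

locale expanding_unimodal =
  fixes a b c :: real and g :: "real \<Rightarrow> real"
  assumes unimodal: "unimodal a b g c"
    and expand: "\<And>p u v q. \<lbrakk>a \<le> p; p < u; u < v; v < q; q \<le> b; q \<le> c \<or> c \<le> p\<rbrakk>
        \<Longrightarrow> cross_ratio p u v q < cross_ratio (g p) (g u) (g v) (g q)"
    and preperiodic_kneading: "preperiodic (kneading g c)"
begin

section \<open>Monotonicity and iteration of the map\<close>

lemma ac: "a < c" and cb: "c < b"
  and cont: "continuous_on {a..b} g"
  and ga [simp]: "g a = a" and gb [simp]: "g b = a"
  using unimodal by (auto simp: unimodal_def)

lemma inc: "\<lbrakk>a \<le> x; x < y; y \<le> c\<rbrakk> \<Longrightarrow> g x < g y"
  using unimodal by (auto simp: unimodal_def strict_mono_on_def)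

lemma inc_le: "\<lbrakk>a \<le> x; x \<le> y; y \<le> c\<rbrakk> \<Longrightarrow> g x \<le> g y"
  using inc[of x y] by (cases "x = y") auto

lemma dec: "\<lbrakk>c \<le> x; x < y; y \<le> b\<rbrakk> \<Longrightarrow> g y < g x"
  using unimodal by (auto simp: unimodal_def monotone_on_def)

lemma dec_le: "\<lbrakk>c \<le> x; x \<le> y; y \<le> b\<rbrakk> \<Longrightarrow> g y \<le> g x"
  using dec[of x y] by (cases "x = y") auto

lemma g_in: "x \<in> {a..b} \<Longrightarrow> g x \<in> {a..b}"
  using unimodal unfolding unimodal_def by blast

lemma g_le_gc: "x \<in> {a..b} \<Longrightarrow> g x \<le> g c"
  using inc_le[of x c] dec_le[of c x] cb by (cases "x \<le> c") auto

lemma it_in: "x \<in> {a..b} \<Longrightarrow> (g ^^ n) x \<in> {a..b}"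
  by (induction n) (use g_in in auto)

lemma it_add: "(g ^^ (m + n)) x = (g ^^ n) ((g ^^ m) x)"
  by (simp add: funpow_add add.commute[of m n])

lemma cont_it: "continuous_on {a..b} (g ^^ n)"
proof (induction n)
  case (Suc n)
  have "continuous_on ((g ^^ n) ` {a..b}) g"
    using it_in by (intro continuous_on_subset[OF cont]) auto
  then show ?case
    using continuous_on_compose[OF Suc] by simp
qed (simp add: id_def)

lemma it_a [simp]: "(g ^^ n) a = a"
  by (induction n) auto

lemma it_b: "n > 0 \<Longrightarrow> (g ^^ n) b = a"
  by (cases n) (simp_all add: funpow_Suc_right del: funpow.simps(2))

lemma c_in: "c \<in> {a..b}" using ac cb by auto

lemma it_Suc_c: "(g ^^ i) (g c) = (g ^^ Suc i) c"
  by (simp add: funpow_swap1)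

text \<open>The parity convention for the symbol at \<open>c\<close> is made for this.\<close>

lemma critical_not_periodic:
  assumes "n > 0"
  shows "(g ^^ n) c \<noteq> c"
proof
  assume ret: "(g ^^ n) c = c"
  define u where "u = kneading g c"
  have per: "(g ^^ (i + n)) (g c) = (g ^^ i) (g c)" for i
    using ret by (simp add: funpow_add funpow_swap1[symmetric])
  have "(\<lambda>i. u (i + n)) = itinerary g c (g c)"
  proof (rule itinerary_unique)
    fix i
    show "u (i + n) \<in> {0, 1}"
      unfolding u_def kneading_def by (rule itinerary_le_1)
    show "(g ^^ i) (g c) < c \<Longrightarrow> u (i + n) = 0"
      unfolding u_def kneading_def by (intro itinerary_below) (simp add: per)
    show "(g ^^ i) (g c) > c \<Longrightarrow> u (i + n) = 1"
      unfolding u_def kneading_def by (intro itinerary_above) (simp add: per)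
    assume *: "(g ^^ i) (g c) = c"
    obtain m where m: "n = Suc m" using assms by (cases n) auto
    have "tau (i + n) u = 0"
      unfolding u_def kneading_def using * by (intro itinerary_critical) (simp add: per)
    then have "even (\<Sum>j<Suc i + n. u j)"
      by (simp add: tau_def lessThan_Suc_atMost[symmetric] even_iff_mod_2_eq_zero del: sum.lessThan_Suc)
    \<comment> \<open>The orbit of \<open>g c\<close> is at \<open>c\<close> at time
      \<open>m = n - 1\<close>, so the first \<open>n\<close> symbols have even sum and removing
      them changes no parity.\<close>
    moreover have "tau m u = 0"
      unfolding u_def kneading_def using ret by (intro itinerary_critical) (simp only: it_Suc_c m)
    then have "even (\<Sum>j<n. u j)"
      by (simp add: m tau_def lessThan_Suc_atMost[symmetric] even_iff_mod_2_eq_zero del: sum.lessThan_Suc)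
    moreover have "(\<Sum>j<Suc i + n. u j) = (\<Sum>j<n. u j) + (\<Sum>j<Suc i. u (j + n))"
    proof -
      have "(\<Sum>j<k + n. u j) = (\<Sum>j<n. u j) + (\<Sum>j<k. u (j + n))" for k
        by (induction k) auto
      then show ?thesis by blast
    qed
    ultimately have "even (\<Sum>j<Suc i. u (j + n))" by simp
    then show "tau i (\<lambda>i. u (i + n)) = 0"
      by (simp add: tau_def lessThan_Suc_atMost[symmetric] even_iff_mod_2_eq_zero del: sum.lessThan_Suc)
  qed
  then have "(shift ^^ n) u = u"
    by (auto simp: funpow_shift u_def kneading_def fun_eq_iff)
  then show False
    using preperiodic_kneading assms unfolding preperiodic_def periodic_def u_def by blast
qed

lemma kneading_eq: "kneading g c i = (if (g ^^ Suc i) c < c then 0 else 1)"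
  using itinerary_below[where g = g and c = c and i = i and x = "g c"]
    itinerary_above[where g = g and c = c and i = i and x = "g c"]
    critical_not_periodic[of "Suc i"]
  unfolding kneading_def it_Suc_c by (metis linorder_neqE_linordered_idom not_less_iff_gr_or_eq zero_less_Suc)

lemma kneading_eventually_periodic:
  obtains N p where "N > 0" "p > 0" "\<And>n. n \<ge> N \<Longrightarrow> (g ^^ (n + p)) c < c \<longleftrightarrow> (g ^^ n) c < c"
proof -
  obtain i p where p: "p > 0" "(shift ^^ p) ((shift ^^ i) (kneading g c)) = (shift ^^ i) (kneading g c)"
    using preperiodic_kneading unfolding preperiodic_def periodic_def by blast
  have "(g ^^ (n + p)) c < c \<longleftrightarrow> (g ^^ n) c < c" if "n \<ge> Suc i" for n
  proof -
    obtain k where k: "n = Suc (k + i)"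
      using le_Suc_ex[OF \<open>n \<ge> Suc i\<close>] by (auto simp: add.commute)
    have "kneading g c (k + p + i) = kneading g c (k + i)"
      using fun_cong[OF p(2), of k] by (simp add: funpow_shift)
    then show ?thesis
      unfolding kneading_eq k by (auto simp: ac_simps split: if_splits)
  qed
  then show thesis using that[of "Suc i" p] p(1) by blast
qed

lemma kneading_not_periodic:
  assumes "p > 0"
  obtains n where "n > 0" "((g ^^ (n + p)) c < c) \<noteq> ((g ^^ n) c < c)"
proof (rule ccontr)
  assume "\<not> thesis"
  then have "(g ^^ (Suc i + p)) c < c \<longleftrightarrow> (g ^^ Suc i) c < c" for i
    using that[of "Suc i"] by blast
  then have "kneading g c (i + p) = kneading g c i" for i
    unfolding kneading_eq by simp
  then have "(shift ^^ p) (kneading g c) = kneading g c"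
    by (auto simp: funpow_shift)
  then show False
    using assms preperiodic_kneading unfolding preperiodic_def periodic_def by blast
qed

text \<open>Otherwise the orbit of \<open>c\<close> stays left of \<open>c\<close>, since
  \<open>g c\<close> is the maximum of \<open>g\<close>, and the kneading sequence is
  constant.\<close>

lemma gc_gt: "c < g c"
proof (rule ccontr)
  assume "\<not> c < g c"
  then have "g c < c" using critical_not_periodic[of 1] by simp
  have "(g ^^ n) c < c" if "n > 0" for n
  proof -
    obtain k where "n = Suc k" using gr0_implies_Suc[OF \<open>n > 0\<close>] by blast
    then show ?thesis
      using g_le_gc[OF it_in[OF c_in, of k]] \<open>g c < c\<close> by simp
  qed
  then show False using kneading_not_periodic[of 1] by (metis add_gr_0 less_one)
qed

subsection \<open>The basin of the left end point\<close>

definition r :: real where "r = Sup {x \<in> {a..c}. g x = x}"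

lemma r_props: "a \<le> r" "r < c" "g r = r"
  and above_r: "\<And>x. \<lbrakk>r < x; x \<le> c\<rbrakk> \<Longrightarrow> x < g x"
proof -
  let ?S = "{x \<in> {a..c}. g x = x}"
  have "continuous_on {a..c} (\<lambda>x. g x - x)"
    using cb by (intro continuous_intros continuous_on_subset[OF cont]) auto
  then have "closed {x \<in> {a..c}. g x - x = 0}"
    by (intro continuous_closed_preimage_constant) auto
  then have cl: "closed ?S" by simp
  have ne: "?S \<noteq> {}" using ac by (auto intro!: exI[of _ a])
  have bd: "bdd_above ?S" by (rule bdd_aboveI[of _ c]) auto
  have "r \<in> ?S" unfolding r_def by (rule closed_contains_Sup[OF ne bd cl])
  then show r: "a \<le> r" "g r = r" "r < c" using gc_gt by (auto simp: less_le)
  fix x assume x: "r < x" "x \<le> c"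
  show "x < g x"
  proof (rule ccontr)
    assume "\<not> x < g x"
    then have "\<exists>z\<ge>x. z \<le> c \<and> g z - z = 0"
      using x r gc_gt cb
      by (intro IVT' continuous_intros continuous_on_subset[OF cont]) auto
    then obtain z where "x \<le> z" "z \<in> ?S" using x r by force
    then have "x \<le> r" using cSup_upper[OF _ bd, of z] by (simp add: r_def)
    then show False using x by simp
  qed
qed

text \<open>The points \<open>a\<close> and \<open>r\<close> are fixed and \<open>q\<close> moves to
  the right. If \<open>s\<close> did not move to the left, the middle interval \<open>[s, r]\<close>
  would not grow and its neighbours would not shrink, so the cross-ratio could not increase.\<close>

lemma below_r:
  assumes "a < s" "s < r"
  shows "g s < s"
proof (rule ccontr)
  assume "\<not> g s < s"
  then have gs: "s \<le> g s" by simp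
  define q where "q = (r + c) / 2"
  have q: "r < q" "q < c" "q < g q"
    using r_props above_r[of q] by (auto simp: q_def)
  have mono: "a < g s" "g s < r" "r < g q"
    using inc[of a s] inc[of s r] inc[of r q] assms r_props q by auto
  have "cross_ratio a s r q < cross_ratio (g a) (g s) (g r) (g q)"
    using assms r_props q cb by (intro expand) auto
  also have "\<dots> = (1 + (r - g s) / (g s - a)) * (1 + (r - g s) / (g q - r)) - 1"
    using cross_ratio_eq[of a "g s" r "g q"] mono r_props by simp
  also have "\<dots> \<le> (1 + (r - s) / (s - a)) * (1 + (r - s) / (q - r)) - 1"
    using mono assms q gs
    by (intro diff_right_mono mult_mono add_left_mono frac_le) auto
  also have "\<dots> = cross_ratio a s r q"
    using cross_ratio_eq[of a s r q] assms q by simp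
  finally show False by simp
qed

lemma le_r_invariant: "\<lbrakk>a \<le> x; x \<le> r\<rbrakk> \<Longrightarrow> a \<le> g x \<and> g x \<le> x"
  using below_r[of x] g_in[of x] r_props cb by (cases "x = a \<or> x = r") auto

lemma it_le_r: "\<lbrakk>a \<le> x; x \<le> r\<rbrakk> \<Longrightarrow> a \<le> (g ^^ n) x \<and> (g ^^ n) x \<le> x"
proof (induction n)
  case (Suc n)
  then show ?case using le_r_invariant[of "(g ^^ n) x"] by auto
qed simp

lemma limit_is_fixed:
  assumes "x \<in> {a..b}" "(\<lambda>n. (g ^^ n) x) \<longlonglongrightarrow> z"
  shows "z \<in> {a..b}" "g z = z"
proof -
  show z: "z \<in> {a..b}"
    using closed_sequentially[OF _ _ assms(2), of "{a..b}"] it_in[OF assms(1)] by blast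
  have "(\<lambda>n. g ((g ^^ n) x)) \<longlonglongrightarrow> g z"
    using continuous_on_tendsto_compose[OF cont assms(2) z] it_in[OF assms(1)] by simp
  moreover have "(\<lambda>n. g ((g ^^ n) x)) \<longlonglongrightarrow> z"
    using LIMSEQ_Suc[OF assms(2)] by simp
  ultimately show "g z = z" by (rule LIMSEQ_unique)
qed

text \<open>The orbit decreases to a fixed point in \<open>[a, x]\<close>, and
  \<open>below_r\<close> leaves only \<open>a\<close>.\<close>

lemma basin_a:
  assumes "a \<le> x" "x < r"
  shows "(\<lambda>n. (g ^^ n) x) \<longlonglongrightarrow> a"
proof -
  have xin: "x \<in> {a..b}" using assms r_props cb by auto
  have "decseq (\<lambda>n. (g ^^ n) x)"
    unfolding decseq_Suc_iff
  proof
    fix n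
    show "(g ^^ Suc n) x \<le> (g ^^ n) x"
      using le_r_invariant[of "(g ^^ n) x"] it_le_r[of x n] assms by simp
  qed
  moreover have "\<forall>n. a \<le> (g ^^ n) x" using it_in[OF xin] by auto
  ultimately obtain z where z: "(\<lambda>n. (g ^^ n) x) \<longlonglongrightarrow> z" "\<forall>n. z \<le> (g ^^ n) x"
    using decseq_convergent by blast
  have "z \<le> x" using z(2) by (metis funpow_0)
  then have "z = a"
    using limit_is_fixed[OF xin z(1)] below_r[of z] assms by force
  then show ?thesis using z by simp
qed

text \<open>A point right of \<open>r\<close> would increase under iteration to a fixed point in
  \<open>(r, c]\<close>, where there is none.\<close>

lemma forever_left_le_r:
  assumes "x \<in> {a..b}" "\<And>n. (g ^^ n) x \<le> c"
  shows "x \<le> r"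
proof (rule ccontr)
  assume "\<not> x \<le> r"
  then have "r < x" by simp
  have above: "r < (g ^^ n) x \<and> x \<le> (g ^^ n) x" for n
  proof (induction n)
    case (Suc n)
    then show ?case using above_r[of "(g ^^ n) x"] assms(2)[of n] by auto
  qed (use \<open>r < x\<close> in auto)
  have "incseq (\<lambda>n. (g ^^ n) x)"
    unfolding incseq_Suc_iff
    using above above_r assms(2) by (simp add: less_imp_le)
  moreover have "\<forall>n. (g ^^ n) x \<le> c" using assms(2) by blast
  ultimately obtain z where z: "(\<lambda>n. (g ^^ n) x) \<longlonglongrightarrow> z" "\<forall>n. (g ^^ n) x \<le> z"
    using incseq_convergent by blast
  have "x \<le> z" using z(2) by (metis funpow_0)
  moreover have "z \<le> c" using LIMSEQ_le_const2[OF z(1)] assms(2) by blast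
  ultimately show False
    using limit_is_fixed[OF assms(1) z(1)] above_r[of z] \<open>r < x\<close> by simp
qed

subsection \<open>Intervals on which all iterates are monotone\<close>

text \<open>Both sides contain \<open>c\<close>. So the points following given sides form a closed
  set, while \<open>g\<close> is still strictly monotone on each side.\<close>

definition side :: "bool \<Rightarrow> real \<Rightarrow> bool" where
  "side t z \<longleftrightarrow> (if t then c \<le> z else z \<le> c)"

definition follows_upto :: "nat \<Rightarrow> (nat \<Rightarrow> bool) \<Rightarrow> real \<Rightarrow> bool" where
  "follows_upto n s x \<longleftrightarrow> x \<in> {a..b} \<and> (\<forall>i<n. side (s i) ((g ^^ i) x))"

definition follows :: "(nat \<Rightarrow> bool) \<Rightarrow> real \<Rightarrow> bool" where
  "follows s x \<longleftrightarrow> x \<in> {a..b} \<and> (\<forall>i. side (s i) ((g ^^ i) x))"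

lemma follows_imp_upto: "follows s x \<Longrightarrow> follows_upto n s x"
  by (simp add: follows_def follows_upto_def)

lemma follows_iff_upto: "follows s x \<longleftrightarrow> (\<forall>n. follows_upto n s x)"
  by (auto simp: follows_def follows_upto_def)

lemma follows_shift: "follows s x \<Longrightarrow> follows (\<lambda>i. s (i + n)) ((g ^^ n) x)"
  using it_in[of x n] by (auto simp: follows_def it_add[symmetric] add.commute)

lemma follows_upto_order:
  assumes "follows_upto n s x" "follows_upto n s y" "x < y"
  shows "if orientation s n then (g ^^ n) x < (g ^^ n) y else (g ^^ n) y < (g ^^ n) x"
  using assms
proof (induction n)
  case (Suc n)
  have ord: "if orientation s n then (g ^^ n) x < (g ^^ n) y else (g ^^ n) y < (g ^^ n) x"
    using Suc by (auto simp: follows_upto_def)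
  have sd: "side (s n) ((g ^^ n) x)" "side (s n) ((g ^^ n) y)"
    using Suc.prems by (auto simp: follows_upto_def)
  have inab: "(g ^^ n) x \<in> {a..b}" "(g ^^ n) y \<in> {a..b}"
    using Suc.prems it_in by (auto simp: follows_upto_def)
  show ?case
    using ord sd inab inc[of "(g ^^ n) x" "(g ^^ n) y"] inc[of "(g ^^ n) y" "(g ^^ n) x"]
      dec[of "(g ^^ n) x" "(g ^^ n) y"] dec[of "(g ^^ n) y" "(g ^^ n) x"]
    by (cases "s n"; cases "orientation s n") (auto simp: side_def)
qed simp

lemma follows_upto_convex:
  assumes "follows_upto n s x" "follows_upto n s y" "x \<le> z" "z \<le> y"
  shows "follows_upto n s z"
  using assms
proof (induction n)
  case (Suc n)
  then have z: "follows_upto n s z" "follows_upto n s x" "follows_upto n s y"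
    by (auto simp: follows_upto_def)
  have sd: "side (s n) ((g ^^ n) x)" "side (s n) ((g ^^ n) y)"
    using Suc.prems by (auto simp: follows_upto_def)
  have "side (s n) ((g ^^ n) z)"
    using follows_upto_order[OF z(2,1)] follows_upto_order[OF z(1,3)] Suc.prems(3,4) sd
    by (cases "z = x"; cases "z = y"; cases "s n"; cases "orientation s n") (auto simp: side_def)
  then show ?case using z(1) by (auto simp: follows_upto_def less_Suc_eq)
qed (auto simp: follows_upto_def)

lemma follows_convex:
  "\<lbrakk>follows s x; follows s y; x \<le> z; z \<le> y\<rbrakk> \<Longrightarrow> follows s z"
  using follows_upto_convex unfolding follows_iff_upto by blast

lemma cross_ratio_step:
  assumes "p \<in> {a..b}" "q \<in> {a..b}" "side t p" "side t q"
    and "p < u \<and> u < v \<and> v < q \<or> q < v \<and> v < u \<and> u < p"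
  shows "cross_ratio p u v q < cross_ratio (g p) (g u) (g v) (g q)"
  using assms(5)
proof
  assume "p < u \<and> u < v \<and> v < q"
  then show ?thesis
    using assms(1-4) by (intro expand) (auto simp: side_def split: if_splits)
next
  assume "q < v \<and> v < u \<and> u < p"
  then have "cross_ratio q v u p < cross_ratio (g q) (g v) (g u) (g p)"
    using assms(1-4) by (intro expand) (auto simp: side_def split: if_splits)
  then show ?thesis by (simp add: cross_ratio_rev)
qed

lemma cross_ratio_it:
  assumes "follows_upto n s p" "follows_upto n s q" "p < u" "u < v" "v < q"
  shows "n = 0 \<or> cross_ratio p u v q < cross_ratio ((g ^^ n) p) ((g ^^ n) u) ((g ^^ n) v) ((g ^^ n) q)"
  using assms
proof (induction n)
  case (Suc n)
  then have pq: "follows_upto n s p" "follows_upto n s q"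
    by (auto simp: follows_upto_def)
  have uv: "follows_upto n s u" "follows_upto n s v"
    using follows_upto_convex[OF pq] Suc.prems by auto
  have sd: "side (s n) ((g ^^ n) p)" "side (s n) ((g ^^ n) q)"
    using Suc.prems by (auto simp: follows_upto_def)
  have "cross_ratio ((g ^^ n) p) ((g ^^ n) u) ((g ^^ n) v) ((g ^^ n) q) <
      cross_ratio (g ((g ^^ n) p)) (g ((g ^^ n) u)) (g ((g ^^ n) v)) (g ((g ^^ n) q))"
  proof (rule cross_ratio_step[OF _ _ sd])
    show "(g ^^ n) p \<in> {a..b}" "(g ^^ n) q \<in> {a..b}"
      using pq it_in by (auto simp: follows_upto_def)
    show "(g ^^ n) p < (g ^^ n) u \<and> (g ^^ n) u < (g ^^ n) v \<and> (g ^^ n) v < (g ^^ n) q \<or>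
        (g ^^ n) q < (g ^^ n) v \<and> (g ^^ n) v < (g ^^ n) u \<and> (g ^^ n) u < (g ^^ n) p"
      using follows_upto_order[OF pq(1) uv(1)] follows_upto_order[OF uv]
        follows_upto_order[OF uv(2) pq(2)] Suc.prems by (auto split: if_splits)
  qed
  then show ?case using Suc.IH[OF pq] Suc.prems by (cases "n = 0") auto
qed simp

text \<open>Off \<open>c\<close> each of the finitely many side conditions is open. It is used to
  move slightly beyond the end points of a maximal interval of points following
  \<open>s\<close>.\<close>

lemma follows_upto_nhd:
  assumes "follows_upto n s x" "\<And>i. i < n \<Longrightarrow> (g ^^ i) x \<noteq> c"
  obtains e where "e > 0" "\<And>z. \<lbrakk>z \<in> {a..b}; \<bar>z - x\<bar> < e\<rbrakk> \<Longrightarrow> follows_upto n s z"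
  using assms
proof (induction n arbitrary: thesis)
  case 0
  then show ?case by (auto simp: follows_upto_def intro: 0(1)[of 1])
next
  case (Suc n)
  have x: "x \<in> {a..b}" and sd: "side (s n) ((g ^^ n) x)"
    using Suc.prems by (auto simp: follows_upto_def)
  obtain e where e: "e > 0" "\<And>z. \<lbrakk>z \<in> {a..b}; \<bar>z - x\<bar> < e\<rbrakk> \<Longrightarrow> follows_upto n s z"
    using Suc.IH Suc.prems by (auto simp: follows_upto_def)
  have "\<bar>(g ^^ n) x - c\<bar> > 0" using Suc.prems(3)[of n] by simp
  then obtain d where d: "d > 0"
      "\<And>z. \<lbrakk>z \<in> {a..b}; \<bar>z - x\<bar> < d\<rbrakk> \<Longrightarrow> \<bar>(g ^^ n) z - (g ^^ n) x\<bar> < \<bar>(g ^^ n) x - c\<bar>"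
    using cont_it[of n] x unfolding continuous_on_iff dist_real_def by meson
  have "follows_upto (Suc n) s z" if "z \<in> {a..b}" "\<bar>z - x\<bar> < min d e" for z
  proof -
    have "\<bar>(g ^^ n) z - (g ^^ n) x\<bar> < \<bar>(g ^^ n) x - c\<bar>" using d that by simp
    then have "side (s n) ((g ^^ n) z)"
      using sd by (cases "s n") (auto simp: side_def abs_if split: if_splits)
    then show ?thesis
      using e(2)[of z] that by (auto simp: follows_upto_def less_Suc_eq)
  qed
  then show ?case using Suc.prems(1)[of "min d e"] d e by auto
qed

lemma closed_follows_upto: "closed {x. follows_upto n s x}"
proof (induction n)
  case 0
  have "{x. follows_upto 0 s x} = {a..b}" by (auto simp: follows_upto_def)
  then show ?case by simp
next
  case (Suc n)
  have "Collect (side t) = (if t then {c..} else {..c})" for t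
    by (auto simp: side_def)
  then have "closed (Collect (side (s n)))" by simp
  then have "closed ({a..b} \<inter> (g ^^ n) -` Collect (side (s n)))"
    by (rule continuous_closed_preimage[OF cont_it closed_atLeastAtMost])
  then have "closed {x \<in> {a..b}. (g ^^ n) x \<in> Collect (side (s n))}"
    by (simp add: vimage_def Int_def)
  moreover have "{x. follows_upto (Suc n) s x} =
     {x. follows_upto n s x} \<inter> {x \<in> {a..b}. (g ^^ n) x \<in> Collect (side (s n))}"
    by (auto simp: follows_upto_def less_Suc_eq)
  ultimately show ?case using Suc by auto
qed

lemma closed_follows: "closed {x. follows s x}"
proof -
  have "{x. follows s x} = (\<Inter>n. {x. follows_upto n s x})"
    by (auto simp: follows_iff_upto)
  then show ?thesis using closed_follows_upto by auto
qed

lemma extremal_points: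
  assumes "closed S" "S \<subseteq> {a..b}" "S \<noteq> {}"
  shows "Inf S \<in> S" "Sup S \<in> S" "\<And>x. x \<in> S \<Longrightarrow> Inf S \<le> x \<and> x \<le> Sup S"
proof -
  have bd: "bdd_below S" "bdd_above S"
    using assms(2) by (meson bdd_below_Icc bdd_below_mono, meson bdd_above_Icc bdd_above_mono)
  show "Inf S \<in> S" by (rule closed_contains_Inf[OF assms(3) bd(1) assms(1)])
  show "Sup S \<in> S" by (rule closed_contains_Sup[OF assms(3) bd(2) assms(1)])
  show "\<And>x. x \<in> S \<Longrightarrow> Inf S \<le> x \<and> x \<le> Sup S"
    using cInf_lower cSup_upper bd by blast
qed

text \<open>Along \<open>s\<close> the map \<open>g^m\<close> is increasing and moves both end
  points inwards, so it maps \<open>[x, y]\<close> into itself; by periodicity of \<open>s\<close>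
  the first \<open>m\<close> sides are then repeated forever.\<close>

lemma trapped_follows:
  assumes "follows_upto m s x" "follows_upto m s y" "x \<le> y"
    and "orientation s m" "m > 0" "\<And>i. s (i + m) = s i"
    and "x \<le> (g ^^ m) x" "(g ^^ m) y \<le> y" "z \<in> {x..y}"
  shows "follows s z"
proof -
  have W: "follows_upto m s w" if "w \<in> {x..y}" for w
    by (rule follows_upto_convex[OF assms(1,2)]) (use that in auto)
  have inv: "(g ^^ m) w \<in> {x..y}" if "w \<in> {x..y}" for w
    using follows_upto_order[OF assms(1) W[OF that]] follows_upto_order[OF W[OF that] assms(2)]
      assms that by (cases "w = x"; cases "w = y") auto
  have inv_k: "(g ^^ (m * k)) z \<in> {x..y}" for k
  proof (induction k)
    case (Suc k)
    then show ?case using inv[OF Suc] by (simp add: it_add[of "m * k" m, symmetric] add.commute)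
  qed (use assms in auto)
  have per: "s (i + m * k) = s i" for i k
  proof (induction k)
    case (Suc k)
    then show ?case using assms(6)[of "i + m * k"] by (simp add: ac_simps)
  qed simp
  have "side (s n) ((g ^^ n) z)" for n
  proof -
    have "n mod m < m" using assms by simp
    then have "side (s (n mod m)) ((g ^^ (n mod m)) ((g ^^ (m * (n div m))) z))"
      using W[OF inv_k] by (auto simp: follows_upto_def)
    then show ?thesis
      using per[of "n mod m" "n div m"] by (simp add: it_add[symmetric])
  qed
  then show ?thesis using assms W[of z] by (auto simp: follows_def follows_upto_def)
qed

text \<open>
  The maximal interval \<open>[l, u]\<close> of points following \<open>s\<close> is fixed by \<open>g\<^sup>m\<close> at both ends, and by
  maximality nearby points outside are moved away from it; so \<open>g\<^sup>m\<close> does not expand the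
  cross-ratio of \<open>[l, u]\<close> in a slightly larger interval. The only escape is \<open>l = a\<close>.
\<close>

lemma periodic_side_le_r:
  assumes xy: "follows s x" "follows s y" "x < y" and p: "p > 0" and per: "\<And>i. s (i + p) = s i"
  shows "y \<le> r"
proof -
  define M where "M = {z. follows s z}"
  define l where "l = Inf M"
  define u where "u = Sup M"
  have M: "closed M" "M \<subseteq> {a..b}" "M \<noteq> {}"
    using closed_follows xy by (auto simp: M_def follows_def)
  note ext = extremal_points[OF M, folded l_def u_def]
  have fl: "follows s l" and fu: "follows s u"
    using ext(1,2) by (auto simp: M_def)
  have lu: "l < u" using ext(3)[of x] ext(3)[of y] xy by (auto simp: M_def)
  have lab: "a \<le> l" "u \<le> b" using fl fu by (auto simp: follows_def)
  \<comment> \<open>After a visit to \<open>c\<close> the sides of the orbit are the kneading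
    sequence, which would inherit the period \<open>p\<close>.\<close>
  have no_hit: "(g ^^ i) z \<noteq> c" if z: "follows s z" for z i
  proof
    assume "(g ^^ i) z = c"
    then have C: "(g ^^ n) c = (g ^^ (i + n)) z" for n by (simp add: it_add)
    have "(g ^^ n) c < c \<longleftrightarrow> \<not> s (i + n)" if "n > 0" for n
      using z critical_not_periodic[OF that] C[of n]
      by (auto simp: follows_def side_def dest!: spec[of _ "i + n"] split: if_splits)
    moreover have "s (i + (n + p)) = s (i + n)" for n
      using per[of "i + n"] by (simp add: ac_simps)
    ultimately show False
      by (metis kneading_not_periodic[OF p] add_gr_0)
  qed
  \<comment> \<open>Doubling the period makes the orientation even, so that \<open>g^m\<close> is
    increasing along \<open>s\<close>.\<close>
  define m where "m = p + p"
  have m: "m > 0" "\<And>i. s (i + m) = s i"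
    using p per[of "_ + p"] per by (auto simp: m_def add.assoc[symmetric])
  have ori: "orientation s m"
    unfolding m_def orientation_add by (simp add: per)
  have h_in: "follows s ((g ^^ m) z)" if "follows s z" for z
    using follows_shift[OF that, of m] by (simp add: m)
  have hl: "l \<le> (g ^^ m) l" "(g ^^ m) l \<le> u" and hu: "(g ^^ m) u \<le> u" "l \<le> (g ^^ m) u"
    using ext(3) h_in[OF fl] h_in[OF fu] by (auto simp: M_def)
  have order: "(g ^^ m) z < (g ^^ m) w" if "follows_upto m s z" "follows_upto m s w" "z < w" for z w
    using follows_upto_order[OF that] ori by simp
  show ?thesis
  proof (cases "l = a")
    case True
    have "\<not> s n" for n
      using fl ac True by (auto simp: follows_def side_def dest!: spec[of _ n])
    then show ?thesis
      using xy(2) by (intro forever_left_le_r) (auto simp: follows_def side_def)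
  next
    case False
    \<comment> \<open>The point \<open>b\<close> is right of \<open>c\<close>, but all its later
      iterates are \<open>a\<close>.\<close>
    have "u \<noteq> b"
    proof
      assume "u = b"
      then have "s 0" "\<not> s p"
        using fu cb ac p it_b[of p]
        by (auto simp: follows_def side_def split: if_splits dest: spec[of _ 0] spec[of _ p])
      then show False using per[of 0] by simp
    qed
    obtain e1 where e1: "e1 > 0" "\<And>z. \<lbrakk>z \<in> {a..b}; \<bar>z - l\<bar> < e1\<rbrakk> \<Longrightarrow> follows_upto m s z"
      using follows_upto_nhd[OF follows_imp_upto[OF fl] no_hit[OF fl]] by metis
    obtain e2 where e2: "e2 > 0" "\<And>z. \<lbrakk>z \<in> {a..b}; \<bar>z - u\<bar> < e2\<rbrakk> \<Longrightarrow> follows_upto m s z"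
      using follows_upto_nhd[OF follows_imp_upto[OF fu] no_hit[OF fu]] by metis
    have left: "(g ^^ m) z < z" if "z \<in> {a..b}" "\<bar>z - l\<bar> < e1" "z < l" for z
    proof (rule ccontr)
      assume "\<not> (g ^^ m) z < z"
      then have "follows s z"
        using trapped_follows[OF e1(2)[OF that(1,2)] follows_imp_upto[OF fu] _ ori m, of z]
          that hu lu by simp
      then show False using ext(3)[of z] that by (auto simp: M_def)
    qed
    have right: "z < (g ^^ m) z" if "z \<in> {a..b}" "\<bar>z - u\<bar> < e2" "u < z" for z
    proof (rule ccontr)
      assume "\<not> z < (g ^^ m) z"
      then have "follows s z"
        using trapped_follows[OF follows_imp_upto[OF fl] e2(2)[OF that(1,2)] _ ori m, of z]
          that hl lu by simp
      then show False using ext(3)[of z] that by (auto simp: M_def)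
    qed
    \<comment> \<open>If \<open>l\<close> moved to the right, continuity would carry a point
      slightly left of \<open>l\<close> to the right as well, against \<open>left\<close>.\<close>
    have fix_l: "(g ^^ m) l = l"
    proof (rule ccontr)
      assume "(g ^^ m) l \<noteq> l"
      then have "(g ^^ m) l - l > 0" using hl by simp
      then obtain d where d: "d > 0"
          "\<And>z. \<lbrakk>z \<in> {a..b}; \<bar>z - l\<bar> < d\<rbrakk> \<Longrightarrow> \<bar>(g ^^ m) z - (g ^^ m) l\<bar> < (g ^^ m) l - l"
        using cont_it[of m] fl unfolding continuous_on_iff dist_real_def follows_def by metis
      define z where "z = max a (l - min d e1 / 2)"
      have z: "z \<in> {a..b}" "z < l" "\<bar>z - l\<bar> < d" "\<bar>z - l\<bar> < e1"
        using d(1) e1(1) False lab lu by (auto simp: z_def max_def min_def field_simps split: if_splits)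
      then show False using d(2)[of z] left[of z] by auto
    qed
    have fix_u: "(g ^^ m) u = u"
    proof (rule ccontr)
      assume "(g ^^ m) u \<noteq> u"
      then have "u - (g ^^ m) u > 0" using hu by simp
      then obtain d where d: "d > 0"
          "\<And>z. \<lbrakk>z \<in> {a..b}; \<bar>z - u\<bar> < d\<rbrakk> \<Longrightarrow> \<bar>(g ^^ m) z - (g ^^ m) u\<bar> < u - (g ^^ m) u"
        using cont_it[of m] fu unfolding continuous_on_iff dist_real_def follows_def by metis
      define z where "z = min b (u + min d e2 / 2)"
      have z: "z \<in> {a..b}" "u < z" "\<bar>z - u\<bar> < d" "\<bar>z - u\<bar> < e2"
        using d(1) e2(1) \<open>u \<noteq> b\<close> lab lu by (auto simp: z_def min_def field_simps split: if_splits)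
      then show False using d(2)[of z] right[of z] by auto
    qed
    define z where "z = max a (l - e1 / 2)"
    have z: "z \<in> {a..b}" "z < l" "\<bar>z - l\<bar> < e1"
      using e1(1) False lab lu by (auto simp: z_def max_def field_simps split: if_splits)
    define w where "w = min b (u + e2 / 2)"
    have w: "w \<in> {a..b}" "u < w" "\<bar>w - u\<bar> < e2"
      using e2(1) \<open>u \<noteq> b\<close> lab lu by (auto simp: w_def min_def field_simps split: if_splits)
    have hz: "(g ^^ m) z < z" and hw: "w < (g ^^ m) w"
      using left[OF z(1,3,2)] right[OF w(1,3,2)] by auto
    have "cross_ratio z l u w < cross_ratio ((g ^^ m) z) l u ((g ^^ m) w)"
      using cross_ratio_it[OF e1(2)[OF z(1,3)] e2(2)[OF w(1,3)] z(2) lu w(2)] m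
      by (simp add: fix_l fix_u)
    also have "\<dots> = (1 + (u - l) / (l - (g ^^ m) z)) * (1 + (u - l) / ((g ^^ m) w - u)) - 1"
      using hz hw z w by (intro cross_ratio_eq) auto
    also have "\<dots> \<le> (1 + (u - l) / (l - z)) * (1 + (u - l) / (w - u)) - 1"
      using hz hw z w lu by (intro diff_right_mono mult_mono add_left_mono frac_le) auto
    also have "\<dots> = cross_ratio z l u w"
      using z w by (intro cross_ratio_eq[symmetric]) auto
    finally show ?thesis by simp
  qed
qed

text \<open>
  If the orbit stays right of \<open>r\<close>, two of its points eventually follow the same periodic sides and
  hence coincide.
\<close>

lemma critical_orbit_cases:
  "g (g c) < r \<or> finite (range (\<lambda>n. (g ^^ n) c)) \<and> (\<forall>n>0. r \<le> (g ^^ n) c)"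
proof (cases "g (g c) < r")
  case False
  \<comment> \<open>If \<open>g (g c)\<close> is not below \<open>r\<close>, the interval
    \<open>[r, g c]\<close> is invariant.\<close>
  have step: "r \<le> g x \<and> g x \<le> g c" if "r \<le> x" "x \<le> g c" for x
  proof -
    have x: "x \<in> {a..b}" using that r_props g_in[OF c_in] by auto
    have "r \<le> g x"
    proof (cases "x \<le> c")
      case True
      then show ?thesis using inc_le[of r x] r_props that by auto
    next
      case c: False
      then show ?thesis using dec_le[of x "g c"] False that g_in[OF c_in] by auto
    qed
    then show ?thesis using g_le_gc[OF x] by simp
  qed
  have ge: "r \<le> (g ^^ n) c \<and> (g ^^ n) c \<le> g c" for n
    by (induction n) (use step r_props gc_gt in auto)
  obtain N p where p: "N > 0" "p > 0" and
    per: "\<And>n. n \<ge> N \<Longrightarrow> (g ^^ (n + p)) c < c \<longleftrightarrow> (g ^^ n) c < c"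
    using kneading_eventually_periodic by metis
  define s where "s = (\<lambda>i. \<not> (g ^^ (N + i)) c < c)"
  have s_per: "s (i + p) = s i" for i
    using per[of "N + i"] by (simp add: s_def add.assoc)
  have f1: "follows s ((g ^^ N) c)"
    using it_in[OF c_in, of N] by (auto simp: follows_def s_def side_def it_add[symmetric])
  have f2: "follows s ((g ^^ (N + p)) c)"
    using follows_shift[OF f1, of p] s_per by (simp add: it_add)
  \<comment> \<open>Both points are at least \<open>r\<close>. If they differed, the larger one
    would exceed \<open>r\<close>, against \<open>periodic_side_le_r\<close>.\<close>
  have eq: "(g ^^ (N + p)) c = (g ^^ N) c"
    using periodic_side_le_r[OF f1 f2 _ p(2) s_per] periodic_side_le_r[OF f2 f1 _ p(2) s_per]
      ge[of N] ge[of "N + p"] by (meson leD le_less_trans linorder_less_linear)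
  have "(g ^^ n) c \<in> (\<lambda>n. (g ^^ n) c) ` {..<N + p}" for n
  proof (induction n rule: less_induct)
    case (less n)
    show ?case
    proof (cases "n < N + p")
      case False
      then obtain k where k: "n = (N + p) + k" using le_Suc_ex not_less by blast
      then have "(g ^^ n) c = (g ^^ (N + k)) c"
        using eq by (simp add: it_add)
      then show ?thesis using less[of "N + k"] k p by simp
    qed auto
  qed
  then have "range (\<lambda>n. (g ^^ n) c) \<subseteq> (\<lambda>n. (g ^^ n) c) ` {..<N + p}" by blast
  then have "finite (range (\<lambda>n. (g ^^ n) c))"
    by (rule finite_subset) simp
  then show ?thesis using ge by auto
qed simp

section \<open>Postcritical set and wandering intervals\<close>

text \<open>The point \<open>a\<close> is included as the image of both end points of the interval,
  so that all images of maximal intervals of monotonicity end in this set.\<close>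

definition postcritical :: "real set" where
  "postcritical = insert a {(g ^^ n) c | n. n > 0}"

lemma postcritical_in: "p \<in> postcritical \<Longrightarrow> p \<in> {a..b}"
  using it_in[OF c_in] ac cb by (auto simp: postcritical_def)

lemma postcritical_invariant: "p \<in> postcritical \<Longrightarrow> g p \<in> postcritical"
  unfolding postcritical_def by (auto intro: exI[of _ "Suc _"])

lemma c_not_postcritical: "c \<notin> postcritical"
  using critical_not_periodic ac by (auto simp: postcritical_def dest: sym)

text \<open>By \<open>follows_upto_nhd\<close> an end point that never meets \<open>c\<close> before
  time \<open>n\<close> could be moved outwards unless it is \<open>a\<close> or \<open>b\<close>;
  for \<open>n > 0\<close> these two are mapped to \<open>a\<close>.\<close>

lemma monotone_extent:
  assumes "follows_upto n s x" "n > 0"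
  obtains l u where "follows_upto n s l" "follows_upto n s u" "l \<le> x" "x \<le> u"
    "\<And>z. follows_upto n s z \<Longrightarrow> l \<le> z \<and> z \<le> u"
    "(g ^^ n) l \<in> postcritical" "(g ^^ n) u \<in> postcritical"
proof -
  define S where "S = {z. follows_upto n s z}"
  have S: "closed S" "S \<subseteq> {a..b}" "S \<noteq> {}"
    using closed_follows_upto assms by (auto simp: S_def follows_upto_def)
  note ext = extremal_points[OF S]
  have post: "(g ^^ n) z \<in> postcritical" if "(g ^^ i) z = c" "i < n" for z i
  proof -
    have "(g ^^ n) z = (g ^^ (n - i)) c"
      using it_add[of i "n - i" z] that by simp
    then show ?thesis using that(2) by (auto simp: postcritical_def intro!: exI[of _ "n - i"])
  qed
  have fl: "follows_upto n s (Inf S)" and fu: "follows_upto n s (Sup S)"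
    using ext(1,2) by (auto simp: S_def)
  have "(g ^^ n) (Inf S) \<in> postcritical"
  proof (cases "\<exists>i<n. (g ^^ i) (Inf S) = c")
    case False
    then obtain e where e: "e > 0" "\<And>z. \<lbrakk>z \<in> {a..b}; \<bar>z - Inf S\<bar> < e\<rbrakk> \<Longrightarrow> z \<in> S"
      using follows_upto_nhd[OF fl] unfolding S_def mem_Collect_eq by metis
    have "Inf S = a"
    proof (rule ccontr)
      assume "Inf S \<noteq> a"
      then have "a < Inf S" "Inf S \<le> b" using fl by (auto simp: follows_upto_def)
      then have "max a (Inf S - e / 2) \<in> S" "max a (Inf S - e / 2) < Inf S"
        using e(1) by (auto intro!: e(2) simp: max_def)
      then show False using ext(3) by fastforce
    qed
    then show ?thesis by (simp add: postcritical_def)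
  qed (use post in blast)
  moreover have "(g ^^ n) (Sup S) \<in> postcritical"
  proof (cases "\<exists>i<n. (g ^^ i) (Sup S) = c")
    case False
    then obtain e where e: "e > 0" "\<And>z. \<lbrakk>z \<in> {a..b}; \<bar>z - Sup S\<bar> < e\<rbrakk> \<Longrightarrow> z \<in> S"
      using follows_upto_nhd[OF fu] unfolding S_def mem_Collect_eq by metis
    have "Sup S = b"
    proof (rule ccontr)
      assume "Sup S \<noteq> b"
      then have "Sup S < b" "a \<le> Sup S" using fu by (auto simp: follows_upto_def)
      then have "min b (Sup S + e / 2) \<in> S" "Sup S < min b (Sup S + e / 2)"
        using e(1) by (auto intro!: e(2) simp: min_def)
      then show False using ext(3) by fastforce
    qed
    then show ?thesis using it_b[OF assms(2)] by (simp add: postcritical_def)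
  qed (use post in blast)
  ultimately show thesis
    using that[OF fl fu] ext(3) assms(1) by (auto simp: S_def)
qed

text \<open>
  The images of \<open>[x, y]\<close> are disjoint, so their lengths tend to \<open>0\<close>, while the cross-ratio of
  \<open>[x, y]\<close> in the maximal interval of monotonicity of \<open>g\<^sup>n\<close> stays bounded below. As it is expanded,
  the images must approach the end points of the images of these maximal intervals, which are
  postcritical. Shadowing a finite postcritical set forces the sides to be eventually periodic.
\<close>

lemma no_wandering_interval:
  assumes xy: "follows s x" "follows s y" "x < y"
    and nonper: "\<And>N p. p > 0 \<Longrightarrow> \<exists>i\<ge>N. s (i + p) \<noteq> s i"
  shows False
proof -
  define X where "X = (\<lambda>n. (g ^^ n) x)"
  define Y where "Y = (\<lambda>n. (g ^^ n) y)"
  have X_in: "X n \<in> {a..b}" and Y_in: "Y n \<in> {a..b}" for n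
    using it_in xy by (auto simp: X_def Y_def follows_def)
  have X_Suc: "X (Suc n) = g (X n)" for n by (simp add: X_def)
  have X_side: "side (s n) (X n)" for n
    using xy by (simp add: X_def follows_def)
  have ori: "if orientation s n then X n < Y n else Y n < X n" for n
    unfolding X_def Y_def
    using follows_upto_order[OF follows_imp_upto follows_imp_upto] xy by blast
  have X_ge: "r \<le> X n" for n
  proof (rule ccontr)
    assume "\<not> r \<le> X n"
    then have "(g ^^ k) (X n) \<le> r" for k
      using it_le_r[of "X n" k] X_in[of n] by auto
    then have "\<not> s (n + k)" for k
      using X_side[of "n + k"] r_props(2)
      by (metis X_def it_add le_less_trans not_le side_def)
    then show False
      using nonper[of 1 n] by (metis add.assoc le_iff_add zero_less_one)
  qed
  \<comment> \<open>Interior points stay strictly between the iterates of \<open>x\<close> and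
    \<open>y\<close>, hence never hit \<open>c\<close>, so their sides determine
    \<open>s\<close>.\<close>
  have inside: "(g ^^ n) w < c \<longleftrightarrow> \<not> s n" if "x < w" "w < y" for n w
  proof -
    have w: "follows s w" using follows_convex[OF xy(1,2)] that by simp
    have "if orientation s n then X n < (g ^^ n) w \<and> (g ^^ n) w < Y n
          else Y n < (g ^^ n) w \<and> (g ^^ n) w < X n"
      unfolding X_def Y_def
      using follows_upto_order[OF follows_imp_upto[OF xy(1)] follows_imp_upto[OF w]]
        follows_upto_order[OF follows_imp_upto[OF w] follows_imp_upto[OF xy(2)]] that by simp
    moreover have "side (s n) (X n)" "side (s n) (Y n)"
      using xy by (auto simp: X_def Y_def follows_def)
    ultimately show ?thesis by (auto simp: side_def split: if_splits)
  qed
  define I where "I = (\<lambda>n. {min (X n) (Y n)<..<max (X n) (Y n)})"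
  have I_side: "(g ^^ k) z < c \<longleftrightarrow> \<not> s (n + k)" if "z \<in> I n" for n k z
  proof -
    have "{min (X n) (Y n)..max (X n) (Y n)} \<subseteq> (g ^^ n) ` {x..y}"
    proof -
      have "continuous_on {x..y} (g ^^ n)"
        using xy by (intro continuous_on_subset[OF cont_it]) (auto simp: follows_def)
      then have "connected ((g ^^ n) ` {x..y})"
        by (intro connected_continuous_image) auto
      moreover have "X n \<in> (g ^^ n) ` {x..y}" "Y n \<in> (g ^^ n) ` {x..y}"
        using xy by (auto simp: X_def Y_def)
      ultimately show ?thesis
        by (intro connected_contains_Icc) (auto simp: min_def max_def)
    qed
    moreover have "z \<in> {min (X n) (Y n)..max (X n) (Y n)}" using that by (auto simp: I_def)
    ultimately obtain w where w: "w \<in> {x..y}" "z = (g ^^ n) w" by blast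
    have "w \<noteq> x" "w \<noteq> y" using that w by (auto simp: I_def X_def Y_def)
    then show ?thesis using inside[of w "n + k"] w by (simp add: it_add)
  qed
  \<comment> \<open>A common point would give \<open>s\<close> the same tail from \<open>n\<close>
    and from \<open>m\<close>, making it eventually periodic.\<close>
  have disj: "n = m" if "z \<in> I n" "z \<in> I m" for n m z
  proof (rule ccontr)
    have eq: "s (n + k) = s (m + k)" for k
      using I_side[OF that(1)] I_side[OF that(2)] by blast
    assume "n \<noteq> m"
    then consider "n < m" | "m < n" by linarith
    then show False
    proof cases
      case 1
      obtain i where "i \<ge> n" "s (i + (m - n)) \<noteq> s i" using nonper[of "m - n" n] 1 by auto
      then show False using eq[of "i - n"] 1 by (simp add: add.commute)
    next
      case 2
      obtain i where "i \<ge> m" "s (i + (n - m)) \<noteq> s i" using nonper[of "n - m" m] 2 by auto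
      then show False using eq[of "i - m"] 2 by (simp add: add.commute)
    qed
  qed
  have shrink: "\<exists>N. \<forall>n\<ge>N. \<bar>X n - Y n\<bar> < e" if "e > 0" for e
  proof -
    define B where "B = {n. e \<le> \<bar>X n - Y n\<bar>}"
    \<comment> \<open>An interval of length at least \<open>e\<close> contains a point of the grid
      of mesh \<open>e/2\<close>. Disjointness makes its index \<open>k n\<close> injective, and
      only finitely many indices occur in \<open>[a, b]\<close>.\<close>
    define k where "k = (\<lambda>n. \<lfloor>min (X n) (Y n) / (e/2)\<rfloor> + 1)"
    have kI: "real_of_int (k n) * (e/2) \<in> I n" if "n \<in> B" for n
    proof -
      have "min (X n) (Y n) / (e/2) < real_of_int (k n)" "real_of_int (k n) \<le> min (X n) (Y n) / (e/2) + 1"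
        by (simp_all add: k_def)
      then have "min (X n) (Y n) < real_of_int (k n) * (e/2)"
          "real_of_int (k n) * (e/2) \<le> min (X n) (Y n) + e/2"
        using \<open>e > 0\<close> by (simp_all add: field_simps)
      then show ?thesis using that \<open>e > 0\<close> by (auto simp: I_def B_def min_def max_def split: if_splits)
    qed
    have "inj_on k B"
      by (rule inj_onI) (metis kI disj)
    moreover have "k ` B \<subseteq> {\<lfloor>a / (e/2)\<rfloor> + 1..\<lfloor>b / (e/2)\<rfloor> + 1}"
    proof clarify
      fix n
      have "a / (e/2) \<le> min (X n) (Y n) / (e/2)" "min (X n) (Y n) / (e/2) \<le> b / (e/2)"
        using X_in[of n] Y_in[of n] \<open>e > 0\<close> by (auto intro!: divide_right_mono)
      then show "k n \<in> {\<lfloor>a / (e/2)\<rfloor> + 1..\<lfloor>b / (e/2)\<rfloor> + 1}"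
        unfolding k_def by (auto intro: floor_mono)
    qed
    ultimately have "finite B"
      by (meson finite_atLeastAtMost_int finite_imageD finite_subset)
    then obtain N where "\<And>n. n \<in> B \<Longrightarrow> n < N"
      using finite_nat_set_iff_bounded by auto
    then show ?thesis by (intro exI[of _ N]) (force simp: B_def not_le[symmetric])
  qed
  have near: "\<exists>N. \<forall>n\<ge>N. \<exists>p\<in>postcritical. \<bar>X n - p\<bar> < d" if d: "d > 0" for d
  proof -
    have yx: "0 < y - x" "y - x \<le> b - a" using xy by (auto simp: follows_def)
    \<comment> \<open>If \<open>X n\<close> has distance at least \<open>d\<close> from the
      postcritical set and \<open>Y n\<close> is within \<open>d/2\<close> of \<open>X n\<close>,
      the image cross-ratio is at most \<open>(b - a) * e / (d * (d/2))\<close>. This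
      \<open>e\<close> pushes that bound below \<open>(y - x) / (b - a)\<close>, which bounds the
      original cross-ratio from below for every \<open>n\<close>.\<close>
    define e where "e = min (d/2) ((y - x) * d\<^sup>2 / (2 * (b - a)\<^sup>2))"
    have e: "e > 0" "e \<le> d / 2" "(b - a) * e / (d * (d/2)) \<le> (y - x) / (b - a)"
    proof -
      show "e > 0" "e \<le> d / 2" using d yx by (auto simp: e_def)
      have "e \<le> (y - x) * d\<^sup>2 / (2 * (b - a)\<^sup>2)" by (simp add: e_def)
      then have "(b - a) * e / (d * (d/2)) \<le>
          (b - a) * ((y - x) * d\<^sup>2 / (2 * (b - a)\<^sup>2)) / (d * (d/2))"
        using yx d by (intro divide_right_mono mult_left_mono) auto
      also have "\<dots> = (y - x) / (b - a)"
      proof -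
        have "B * (L * d\<^sup>2 / (2 * B\<^sup>2)) / (d * (d/2)) = L / B" if "B > 0" for B L :: real
          using d that by (simp add: field_simps power2_eq_square)
        then show ?thesis using yx by simp
      qed
      finally show "(b - a) * e / (d * (d/2)) \<le> (y - x) / (b - a)" .
    qed
    obtain N where N: "\<And>n. n \<ge> N \<Longrightarrow> \<bar>X n - Y n\<bar> < e" using shrink[OF e(1)] by blast
    have "\<exists>p\<in>postcritical. \<bar>X n - p\<bar> < d" if n: "n \<ge> Suc N" for n
    proof (rule ccontr)
      assume "\<not> (\<exists>p\<in>postcritical. \<bar>X n - p\<bar> < d)"
      then have far: "\<And>p. p \<in> postcritical \<Longrightarrow> d \<le> \<bar>X n - p\<bar>" by force
      have n0: "n > 0" using n by simp
      obtain l u where lu: "follows_upto n s l" "follows_upto n s u"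
          "\<And>z. follows_upto n s z \<Longrightarrow> l \<le> z \<and> z \<le> u"
          "(g ^^ n) l \<in> postcritical" "(g ^^ n) u \<in> postcritical"
        using monotone_extent[OF follows_imp_upto[OF xy(1)] n0] by metis
      have XY: "\<bar>X n - Y n\<bar> < e" using N n by simp
      have fl: "d \<le> \<bar>X n - (g ^^ n) l\<bar>" and fu: "d / 2 \<le> \<bar>(g ^^ n) u - Y n\<bar>"
        using far[OF lu(4)] far[OF lu(5)] XY e(2) by linarith+
      have "l < x" "y < u"
        using lu(3)[OF follows_imp_upto[OF xy(1)]] lu(3)[OF follows_imp_upto[OF xy(2)]] fl fu d
        by (auto simp: less_le X_def Y_def)
      have in_ab: "a \<le> l" "u \<le> b" "(g ^^ n) l \<in> {a..b}" "(g ^^ n) u \<in> {a..b}"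
        using lu(1,2) it_in by (auto simp: follows_upto_def)
      have "(y - x) / (b - a) \<le> (y - x) / (u - y)"
        using yx \<open>y < u\<close> in_ab xy \<open>l < x\<close> by (intro divide_left_mono) auto
      also have "\<dots> = (x - l) * (y - x) / ((x - l) * (u - y))"
        using \<open>l < x\<close> by simp
      also have "\<dots> \<le> cross_ratio l x y u"
        unfolding cross_ratio_def using \<open>l < x\<close> \<open>y < u\<close> xy
        by (intro divide_right_mono mult_right_mono) auto
      also have "\<dots> < cross_ratio ((g ^^ n) l) (X n) (Y n) ((g ^^ n) u)"
        using cross_ratio_it[OF lu(1,2) \<open>l < x\<close> xy(3) \<open>y < u\<close>] n0 by (simp add: X_def Y_def)
      also have "\<dots> \<le> \<bar>cross_ratio ((g ^^ n) l) (X n) (Y n) ((g ^^ n) u)\<bar>" by simp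
      also have "\<dots> = \<bar>(g ^^ n) u - (g ^^ n) l\<bar> * \<bar>Y n - X n\<bar> /
          (\<bar>X n - (g ^^ n) l\<bar> * \<bar>(g ^^ n) u - Y n\<bar>)"
        by (simp add: cross_ratio_def abs_mult abs_divide)
      also have "\<dots> \<le> (b - a) * e / (d * (d / 2))"
        using XY fl fu d in_ab by (intro frac_le mult_mono) auto
      finally show False using e(3) by simp
    qed
    then show ?thesis by blast
  qed
  from critical_orbit_cases show False
  proof
    assume esc: "g (g c) < r"
    obtain d0 where d0: "d0 > 0" "\<And>z. \<lbrakk>z \<in> {a..b}; \<bar>z - g c\<bar> < d0\<rbrakk> \<Longrightarrow> \<bar>g z - g (g c)\<bar> < r - g (g c)"
      using cont g_in[OF c_in] esc unfolding continuous_on_iff dist_real_def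
      by (metis diff_gt_0_iff_gt)
    \<comment> \<open>Every postcritical point is \<open>g c\<close> or at most
      \<open>g (g c)\<close>. An iterate within \<open>d\<close> of the latter kind is itself below
      \<open>r\<close>, and one within \<open>d\<close> of \<open>g c\<close> is mapped below
      \<open>r\<close>; both contradict \<open>X_ge\<close>.\<close>
    define d where "d = min d0 (r - g (g c))"
    have "d > 0" using d0 esc by (simp add: d_def)
    then obtain n p where p: "p \<in> postcritical" "\<bar>X n - p\<bar> < d"
      using near by blast
    have ggc: "a \<le> g (g c)" using g_in[OF g_in[OF c_in]] by simp
    consider "p \<le> g (g c)" | "p = g c"
    proof -
      assume *: "p \<le> g (g c) \<Longrightarrow> thesis" "p = g c \<Longrightarrow> thesis"
      show thesis
      proof (cases "p = a")
        case False
        then obtain n where n: "n > 0" "p = (g ^^ n) c"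
          using p(1) unfolding postcritical_def by blast
        then obtain k where k: "p = (g ^^ Suc k) c"
          using gr0_implies_Suc by blast
        show thesis
        proof (cases k)
          case (Suc j)
          have "p = (g ^^ j) (g (g c))"
            using k Suc by (simp add: funpow_swap1)
          then show thesis using * it_le_r[of "g (g c)" j] esc ggc by auto
        qed (use k * in auto)
      qed (use * ggc in auto)
    qed
    then show False
    proof cases
      case 1
      then show False using p(2) X_ge[of n] by (auto simp: d_def)
    next
      case 2
      then have "\<bar>g (X n) - g (g c)\<bar> < r - g (g c)"
        using d0(2)[OF X_in] p(2) by (simp add: d_def)
      then show False using X_ge[of "Suc n"] by (simp add: X_Suc)
    qed
  next
    assume fin: "finite (range (\<lambda>n. (g ^^ n) c)) \<and> (\<forall>n>0. r \<le> (g ^^ n) c)"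
    \<comment> \<open>Joining \<open>c\<close> to the separated set makes a nearby postcritical
      point lie on the same side of \<open>c\<close> as \<open>X n\<close>.\<close>
    have finP: "finite (insert c postcritical)"
      by (rule finite_subset[of _ "insert a (range (\<lambda>n. (g ^^ n) c))"])
        (use fin in \<open>auto simp: postcritical_def intro: image_eqI[of _ _ 0]\<close>)
    obtain d where d: "d > 0"
        "\<And>p q. \<lbrakk>p \<in> insert c postcritical; q \<in> insert c postcritical; p \<noteq> q\<rbrakk> \<Longrightarrow> d \<le> \<bar>p - q\<bar>"
    proof -
      define D where "D = (\<lambda>(p, q). \<bar>p - q\<bar>) `
          {(p, q). p \<in> insert c postcritical \<and> q \<in> insert c postcritical \<and> p \<noteq> q}"
      have "finite D" unfolding D_def
        by (intro finite_imageI finite_subset[OF _ finite_cartesian_product[OF finP finP]]) auto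
      moreover have "\<And>t. t \<in> D \<Longrightarrow> t > 0" by (auto simp: D_def)
      ultimately have "Min (insert 1 D) > 0" "\<And>t. t \<in> D \<Longrightarrow> Min (insert 1 D) \<le> t"
        by auto
      then show thesis by (intro that[of "Min (insert 1 D)"]) (auto simp: D_def)
    qed
    have "uniformly_continuous_on {a..b} g"
      using cont by (intro compact_uniformly_continuous) auto
    then obtain e0 where e0: "e0 > 0"
        "\<And>z w. \<lbrakk>z \<in> {a..b}; w \<in> {a..b}; \<bar>z - w\<bar> < e0\<rbrakk> \<Longrightarrow> \<bar>g z - g w\<bar> < d / 2"
      using d(1) unfolding uniformly_continuous_on_def dist_real_def
      by (metis half_gt_zero)
    define e where "e = min e0 (d / 2)"
    have "e > 0" using e0 d by (simp add: e_def)
    then obtain N where N: "\<And>n. n \<ge> N \<Longrightarrow> \<exists>p\<in>postcritical. \<bar>X n - p\<bar> < e"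
      using near by blast
    then obtain P where P: "\<And>n. n \<ge> N \<Longrightarrow> P n \<in> postcritical \<and> \<bar>X n - P n\<bar> < e"
      by metis
    \<comment> \<open>Both sides are postcritical and closer than the minimal distance
      \<open>d\<close>, so the shadowing points form a true orbit. By finiteness it repeats, and the
      sides with it.\<close>
    have P_Suc: "P (Suc n) = g (P n)" if "n \<ge> N" for n
    proof (rule ccontr)
      assume neq: "P (Suc n) \<noteq> g (P n)"
      have "\<bar>g (X n) - g (P n)\<bar> < d / 2"
        using P[OF that] X_in postcritical_in by (intro e0(2)) (auto simp: e_def)
      moreover have "\<bar>X (Suc n) - P (Suc n)\<bar> < d / 2"
        using P[of "Suc n"] that by (simp add: e_def)
      ultimately have "\<bar>P (Suc n) - g (P n)\<bar> < d"
        unfolding X_Suc by linarith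
      then show False
        using d(2)[OF _ _ neq] P[of "Suc n"] P[OF that] that postcritical_invariant by force
    qed
    have P_add: "P (n + k) = (g ^^ k) (P n)" if "n \<ge> N" for n k
      by (induction k) (use P_Suc that in auto)
    have sP: "s n \<longleftrightarrow> c < P n" if "n \<ge> N" for n
    proof -
      have "P n \<noteq> c" using P[OF that] c_not_postcritical by auto
      then have "d \<le> \<bar>P n - c\<bar>" using d(2) P[OF that] by blast
      moreover have "\<bar>X n - P n\<bar> < d" using P[OF that] d(1) by (simp add: e_def)
      ultimately show ?thesis using X_side[of n] by (auto simp: side_def split: if_splits)
    qed
    have "\<not> inj_on P {N..}"
    proof
      assume "inj_on P {N..}"
      moreover have "P ` {N..} \<subseteq> insert c postcritical" using P by auto
      ultimately have "finite {N..}" using finP by (meson finite_imageD finite_subset)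
      then show False by (simp add: infinite_Ici)
    qed
    then obtain n m where nm: "n \<ge> N" "n < m" "P n = P m"
      unfolding inj_on_def by (metis atLeast_iff linorder_neqE_nat)
    have "s (i + (m - n)) = s i" if "i \<ge> n" for i
    proof -
      have "P i = (g ^^ (i - n)) (P n)" using P_add[OF nm(1), of "i - n"] that by simp
      moreover have "P (i + (m - n)) = (g ^^ (i - n)) (P m)"
        using P_add[of m "i - n"] that nm by (simp add: add.commute)
      ultimately show ?thesis
        using sP[of i] sP[of "i + (m - n)"] that nm by simp
    qed
    then show False using nonper[of "m - n" n] nm by auto
  qed
qed

section \<open>Separation of points and choice of the partition\<close>

text \<open>The absence of wandering intervals makes the sides eventually periodic, and the periodic
  case applies from then on. Points following the same sides keep a strict order, so they are still
  distinct at that time.\<close>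

lemma same_sides_le_r:
  assumes "follows s x" "follows s y" "x \<noteq> y"
  obtains n where "(g ^^ n) x \<le> r" "(g ^^ n) y \<le> r"
proof -
  have "\<exists>N p. p > 0 \<and> (\<forall>i\<ge>N. s (i + p) = s i)"
    using no_wandering_interval[OF assms(1,2)] no_wandering_interval[OF assms(2,1)] assms(3)
    by (meson linorder_neqE_linordered_idom)
  then obtain N p where p: "p > 0" "\<And>i. i \<ge> N \<Longrightarrow> s (i + p) = s i" by blast
  have per: "s (i + p + N) = s (i + N)" for i
    using p(2)[of "i + N"] by (simp add: ac_simps)
  have "(g ^^ N) x \<noteq> (g ^^ N) y"
    using follows_upto_order[OF follows_imp_upto follows_imp_upto, of s x y N]
      follows_upto_order[OF follows_imp_upto follows_imp_upto, of s y x N] assms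
    by (metis less_irrefl linorder_neqE_linordered_idom)
  then show thesis
    using that[of N] periodic_side_le_r[OF follows_shift[OF assms(1), of N] follows_shift[OF assms(2), of N] _ p(1) per]
      periodic_side_le_r[OF follows_shift[OF assms(2), of N] follows_shift[OF assms(1), of N] _ p(1) per]
    by linarith
qed

text \<open>
  If \<open>a\<close> attracts, \<open>y\<close> cuts off a neighbourhood \<open>[a, y]\<close> in its basin \<open>[a, r)\<close>; otherwise
  \<open>y = r = a\<close>, and this neighbourhood is degenerate.
\<close>

lemma partition_exists:
  obtains E y y' where "finite E" "E \<subseteq> {y..b}" "{y, c, y', b} \<subseteq> E"
    "a < y \<and> y < r \<or> y = a \<and> r = a" "c < y'" "y' \<le> b" "g y' = y"
    "\<And>e. \<lbrakk>e \<in> E; e \<noteq> y; e \<noteq> b\<rbrakk> \<Longrightarrow> g e \<in> E"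
proof -
  have preimage: "\<exists>y'. c < y' \<and> y' \<le> b \<and> g y' = y" if "a \<le> y" "y \<le> r" for y
  proof -
    have "\<exists>z\<ge>c. z \<le> b \<and> g z = y"
      using that r_props gc_gt cb ac by (intro IVT2' continuous_on_subset[OF cont]) auto
    moreover have "g c \<noteq> y" using that r_props gc_gt by auto
    ultimately show ?thesis by (metis le_less)
  qed
  from critical_orbit_cases show thesis
  proof
    assume esc: "g (g c) < r"
    have gc: "c < g c" "g c \<le> b" "a \<le> g (g c)"
      using gc_gt g_in[OF c_in] g_in[OF g_in[OF c_in]] by auto
    show thesis
    proof (cases "g (g c) = a")
      case False
      then show thesis
        using gc esc r_props cb
        by (intro that[of "{g (g c), r, c, g c, b}" "g (g c)" "g c"]) auto
    next
      case True
      have "g c = b"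
      proof (rule ccontr)
        assume "g c \<noteq> b"
        then show False using dec[of "g c" b] gc True by auto
      qed
      \<comment> \<open>As \<open>g (g c)\<close> is the end point \<open>a\<close> here, any point
        strictly between \<open>a\<close> and \<open>r\<close> is taken instead.\<close>
      define y where "y = (a + r) / 2"
      have y: "a < y" "y < r" using esc True by (auto simp: y_def)
      obtain y' where y': "c < y'" "y' \<le> b" "g y' = y" using preimage[of y] y by auto
      then show thesis
        using y r_props cb \<open>g c = b\<close>
        by (intro that[of "{y, r, c, y', b}" y y']) auto
    qed
  next
    assume fin: "finite (range (\<lambda>n. (g ^^ n) c)) \<and> (\<forall>n>0. r \<le> (g ^^ n) c)"
    let ?O = "range (\<lambda>n. (g ^^ n) c)"
    have O: "z \<in> {r..b}" if "z \<in> ?O" for z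
    proof -
      from that obtain n where "z = (g ^^ n) c" by auto
      then show ?thesis
        using fin it_in[OF c_in, of n] r_props cb by (cases "n = 0") auto
    qed
    have O_inv: "g z \<in> ?O" if "z \<in> ?O" for z
    proof -
      from that obtain n where "z = (g ^^ n) c" by auto
      then have "g z = (g ^^ Suc n) c" by simp
      then show ?thesis by blast
    qed
    have "c \<in> ?O" by (rule range_eqI[of _ _ 0]) simp
    \<comment> \<open>The midpoint covers both alternatives: it lies strictly between
      \<open>a\<close> and \<open>r\<close>, or equals both.\<close>
    define y where "y = (a + r) / 2"
    have y: "a < y \<and> y < r \<or> y = a \<and> r = a" using r_props by (auto simp: y_def)
    obtain y' where y': "c < y'" "y' \<le> b" "g y' = y" using preimage[of y] y r_props by auto
    have E1: "finite ({y, r, y', b} \<union> ?O)" using fin by simp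
    have E2: "{y, r, y', b} \<union> ?O \<subseteq> {y..b}"
    proof -
      have "?O \<subseteq> {y..b}"
      proof
        fix z assume "z \<in> ?O"
        from O[OF this] show "z \<in> {y..b}" using y by auto
      qed
      moreover have "{y, r, y', b} \<subseteq> {y..b}" using y y' r_props cb by auto
      ultimately show ?thesis by blast
    qed
    have E3: "{y, c, y', b} \<subseteq> {y, r, y', b} \<union> ?O" using \<open>c \<in> ?O\<close> by blast
    have E4: "g e \<in> {y, r, y', b} \<union> ?O"
      if "e \<in> {y, r, y', b} \<union> ?O" "e \<noteq> y" "e \<noteq> b" for e
      using that O_inv r_props(3) y'(3) by blast
    show thesis by (rule that[OF E1 E2 E3 y y' E4])
  qed
qed

end

section \<open>Binary expansions\<close>

text \<open>Reduction modulo 2 turns every letter of \<open>{..k}\<close> into a digit, so the tape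
  of digits can share the alphabet of the other tapes.\<close>

definition binary :: "(nat \<Rightarrow> nat) \<Rightarrow> real" where
  "binary v = (\<Sum>i. real (v i mod 2) * (1/2) ^ Suc i)"

lemma summable_binary: "summable (\<lambda>i. real (v i mod 2) * (1/2) ^ Suc i)"
proof (rule summable_comparison_test'[of "\<lambda>i. (1/2) ^ Suc i"])
  show "summable (\<lambda>i. (1/2::real) ^ Suc i)"
    using power_half_series by (rule sums_summable)
  fix n
  have "real (v n mod 2) \<le> 1" by linarith
  then show "norm (real (v n mod 2) * (1/2) ^ Suc n) \<le> (1/2) ^ Suc n"
    by (simp add: mult_left_le_one_le del: power_Suc)
qed

lemma binary_range: "0 \<le> binary v" "binary v \<le> 1"
proof -
  have le: "real (v n mod 2) * (1/2) ^ Suc n \<le> (1/2) ^ Suc n" for n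
  proof -
    have "real (v n mod 2) \<le> 1" by linarith
    then show ?thesis by (simp add: mult_left_le_one_le del: power_Suc)
  qed
  show "0 \<le> binary v"
    unfolding binary_def by (rule suminf_nonneg[OF summable_binary]) simp
  have "binary v \<le> (\<Sum>i. (1/2) ^ Suc i)"
    unfolding binary_def
    by (rule suminf_le[OF le summable_binary sums_summable[OF power_half_series]])
  then show "binary v \<le> 1" using sums_unique[OF power_half_series] by simp
qed

lemma binary_close:
  assumes "\<And>i. i < n \<Longrightarrow> u i = v i"
  shows "\<bar>binary u - binary v\<bar> \<le> (1/2) ^ n"
proof -
  have split: "binary w = (1/2) ^ n * binary (\<lambda>i. w (i + n)) +
      (\<Sum>i<n. real (w i mod 2) * (1/2) ^ Suc i)" for w
  proof -
    have "(\<Sum>i. real (w (i + n) mod 2) * (1/2) ^ Suc (i + n)) =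
        (\<Sum>i. (1/2) ^ n * (real (w (i + n) mod 2) * (1/2) ^ Suc i))"
      by (simp add: power_add ac_simps)
    also have "\<dots> = (1/2) ^ n * binary (\<lambda>i. w (i + n))"
      unfolding binary_def by (rule suminf_mult[OF summable_binary])
    finally show ?thesis
      unfolding binary_def by (subst suminf_split_initial_segment[OF summable_binary, of _ n]) simp
  qed
  have "binary u - binary v = (1/2) ^ n * (binary (\<lambda>i. u (i + n)) - binary (\<lambda>i. v (i + n)))"
    unfolding split[of u] split[of v] using assms by (simp add: right_diff_distrib)
  moreover have "\<bar>binary (\<lambda>i. u (i + n)) - binary (\<lambda>i. v (i + n))\<bar> \<le> 1"
    using binary_range[of "\<lambda>i. u (i + n)"] binary_range[of "\<lambda>i. v (i + n)"] by linarith
  ultimately show ?thesis by (simp add: abs_mult mult_left_le)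
qed

lemma binary_onto:
  assumes "0 \<le> t" "t \<le> 1"
  obtains v where "\<And>i. v i \<le> (1::nat)" "binary v = t"
proof (cases "t = 1")
  case True
  have "binary (\<lambda>_. 1) = 1"
    using sums_unique[OF power_half_series] by (simp add: binary_def)
  then show thesis using that[of "\<lambda>_. 1"] True by simp
next
  case False
  \<comment> \<open>The binary digits of \<open>q n\<close> are the first \<open>n\<close> digits of
    \<open>t\<close>. The value \<open>t = 1\<close> is set apart because it would give
    \<open>q 0 = 1\<close> instead of \<open>0\<close>.\<close>
  define q where "q = (\<lambda>n. \<lfloor>2 ^ n * t\<rfloor>)"
  define v where "v = (\<lambda>i. nat (q (Suc i) - 2 * q i))"
  have bounds: "real_of_int (q n) \<le> 2 ^ n * t" "2 ^ n * t < real_of_int (q n) + 1" for n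
    by (simp_all add: q_def)
  have q_step: "2 * q i \<le> q (Suc i) \<and> q (Suc i) \<le> 2 * q i + 1" for i
  proof -
    have "real_of_int (q (Suc i)) < real_of_int (2 * q i + 2)"
        "real_of_int (2 * q i) < real_of_int (q (Suc i) + 1)"
      using bounds[of i] bounds[of "Suc i"] by simp_all
    then show ?thesis unfolding of_int_less_iff by linarith
  qed
  have v_le: "v i \<le> 1" for i using q_step[of i] by (simp add: v_def nat_le_iff)
  have v_eq: "real (v i mod 2) = real_of_int (q (Suc i)) - 2 * real_of_int (q i)" for i
    using q_step[of i] v_le[of i] by (simp add: v_def)
  have partial: "(\<Sum>i<n. real (v i mod 2) * (1/2) ^ Suc i) = real_of_int (q n) * (1/2) ^ n" for n
  proof (induction n)
    case 0
    have "q 0 = 0" using assms False by (simp add: q_def floor_eq_iff)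
    then show ?case by simp
  next
    case (Suc n)
    then show ?case by (simp add: v_eq algebra_simps)
  qed
  have "(\<lambda>n. real_of_int (q n) * (1/2) ^ n) \<longlonglongrightarrow> t"
  proof (rule LIMSEQ_I)
    fix e :: real assume "0 < e"
    then obtain N where N: "(1/2::real) ^ N < e"
      using real_arch_pow_inv[of e "1/2"] by auto
    have "norm (real_of_int (q n) * (1/2) ^ n - t) < e" if "n \<ge> N" for n
    proof -
      have eq: "real_of_int (q n) * (1/2) ^ n - t = (real_of_int (q n) - 2 ^ n * t) * (1/2) ^ n"
        by (simp add: field_simps)
      have "\<bar>real_of_int (q n) - 2 ^ n * t\<bar> \<le> 1" using bounds[of n] by linarith
      then have "\<bar>(real_of_int (q n) - 2 ^ n * t) * (1/2) ^ n\<bar> \<le> 1 * (1/2) ^ n"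
        unfolding abs_mult by (intro mult_mono) auto
      moreover have "(1/2::real) ^ n \<le> (1/2) ^ N" using that by (intro power_decreasing) auto
      ultimately show ?thesis using N unfolding real_norm_def eq by linarith
    qed
    then show "\<exists>no. \<forall>n\<ge>no. norm (real_of_int (q n) * (1/2) ^ n - t) < e" by blast
  qed
  then have "(\<lambda>i. real (v i mod 2) * (1/2) ^ Suc i) sums t"
    unfolding sums_def partial .
  then have "binary v = t" unfolding binary_def by (rule sums_unique[symmetric])
  then show thesis using that v_le by blast
qed

lemma continuous_map_binary:
  assumes "t \<in> T"
  shows "continuous_map (automaton_space T A) euclideanreal (\<lambda>u. binary (u t))"
proof -
  have "\<exists>U. openin (automaton_space T A) U \<and> u \<in> U \<and> (\<forall>v\<in>U. binary (v t) \<in> ball (binary (u t)) e)"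
    if u: "u \<in> topspace (automaton_space T A)" and "e > 0" for u e
  proof -
    obtain n where n: "(1/2::real) ^ n < e"
      using real_arch_pow_inv[of e "1/2"] \<open>e > 0\<close> by auto
    let ?U = "{v \<in> topspace (automaton_space T A). \<forall>i<n. v t i = u t i}"
    have "openin (automaton_space T A) ?U" by (rule openin_prefix[OF assms])
    moreover have "binary (v t) \<in> ball (binary (u t)) e" if "v \<in> ?U" for v
      using binary_close[of n "u t" "v t"] that n by (simp add: dist_real_def)
    ultimately show ?thesis using u by (intro exI[of _ ?U]) simp
  qed
  then show ?thesis
    using Met_TC.continuous_map_to_metric[of "automaton_space T A" "\<lambda>u. binary (u t)"] by simp
qed

text \<open>An implication is closed if its premise is open and its conclusion closed. The premises
  will be conditions on finitely many symbols.\<close>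

lemma closedin_implies:
  assumes "openin X {u \<in> topspace X. P u}"
    and "closedin (prod_topology X Y) {p \<in> topspace (prod_topology X Y). S p}"
  shows "closedin (prod_topology X Y) {p \<in> topspace (prod_topology X Y). P (fst p) \<longrightarrow> S p}"
proof -
  have "closedin X (topspace X - {u \<in> topspace X. P u})" using assms(1) by blast
  then have "closedin (prod_topology X Y) ((topspace X - {u \<in> topspace X. P u}) \<times> topspace Y)"
    by (simp add: closedin_prod_Times_iff)
  then have "closedin (prod_topology X Y) ((topspace X - {u \<in> topspace X. P u}) \<times> topspace Y \<union>
      {p \<in> topspace (prod_topology X Y). S p})"
    using assms(2) by (rule closedin_Un)
  moreover have "(topspace X - {u \<in> topspace X. P u}) \<times> topspace Y \<union>
      {p \<in> topspace (prod_topology X Y). S p} =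
      {p \<in> topspace (prod_topology X Y). P (fst p) \<longrightarrow> S p}"
    by auto
  ultimately show ?thesis by simp
qed

section \<open>The automaton of a Markov partition\<close>

text \<open>The exceptions \<open>y\<close> and \<open>b\<close> in \<open>E_inv\<close> are mapped
  to \<open>g y\<close> and \<open>a\<close>, which are at most \<open>y\<close>, where the
  partition stops.\<close>

locale markov_partition = expanding_unimodal +
  fixes E :: "real set" and y y' :: real
  assumes finite_E: "finite E" and E_sub: "E \<subseteq> {y..b}" and E_mem: "{y, c, y', b} \<subseteq> E"
    and y: "a < y \<and> y < r \<or> y = a \<and> r = a" and y': "c < y'" "y' \<le> b" "g y' = y"
    and E_inv: "\<And>e. \<lbrakk>e \<in> E; e \<noteq> y; e \<noteq> b\<rbrakk> \<Longrightarrow> g e \<in> E"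
begin

lemma y_bounds: "a \<le> y" "y \<le> r" "y < c" "y < b"
  using y r_props cb by auto

lemma gy: "a \<le> g y" "g y \<le> y"
  using le_r_invariant[of y] y_bounds by auto

definition basics :: "(real \<times> real) set" where
  "basics = {(p, q). p \<in> E \<and> q \<in> E \<and> p < q \<and> E \<inter> {p<..<q} = {}}"

definition k :: nat where "k = card basics"

text \<open>The numbering starts at 1, since the letter 0 stands for \<open>[a, y]\<close>.\<close>

definition box :: "nat \<Rightarrow> real \<times> real" where
  "box = (SOME h. bij_betw h {1..k} basics)"

abbreviation "lo j \<equiv> fst (box j)"
abbreviation "hi j \<equiv> snd (box j)"

lemma finite_basics: "finite basics"
  by (rule finite_subset[OF _ finite_cartesian_product[OF finite_E finite_E]])
    (auto simp: basics_def)

lemma bij_box: "bij_betw box {1..k} basics"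
  unfolding box_def k_def using ex_bij_betw_nat_finite_1[OF finite_basics] by (rule someI_ex)

lemma box_props:
  assumes "1 \<le> j" "j \<le> k"
  shows "lo j \<in> E" "hi j \<in> E" "lo j < hi j" "\<And>e. e \<in> E \<Longrightarrow> e \<le> lo j \<or> hi j \<le> e"
proof -
  have "box j \<in> basics" using bij_betwE[OF bij_box] assms by auto
  then show "lo j \<in> E" "hi j \<in> E" "lo j < hi j" "\<And>e. e \<in> E \<Longrightarrow> e \<le> lo j \<or> hi j \<le> e"
    by (force simp: basics_def)+
qed

lemma box_exists:
  assumes "p \<in> E" "q \<in> E" "p < q" "E \<inter> {p<..<q} = {}"
  obtains j where "1 \<le> j" "j \<le> k" "box j = (p, q)"
proof -
  have "(p, q) \<in> box ` {1..k}"
    using bij_box assms by (auto simp: bij_betw_def basics_def)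
  then show thesis using that by force
qed

lemma box_cover:
  assumes "e \<in> E" "e' \<in> E" "e < e'" "z \<in> {e..e'}"
  obtains j where "1 \<le> j" "j \<le> k" "z \<in> {lo j..hi j}" "e \<le> lo j" "hi j \<le> e'"
proof -
  obtain p q where pq: "p \<in> E" "q \<in> E" "p < q" "E \<inter> {p<..<q} = {}" "z \<in> {p..q}" "e \<le> p" "q \<le> e'"
  proof (cases "z < e'")
    case True
    let ?P = "{x \<in> E. x \<le> z}" and ?Q = "{x \<in> E. z < x}"
    have fin: "finite ?P" "finite ?Q" using finite_E by auto
    have ne: "e \<in> ?P" "e' \<in> ?Q" using assms True by auto
    have P: "Max ?P \<in> ?P" and Q: "Min ?Q \<in> ?Q"
      using Max_in[OF fin(1)] Min_in[OF fin(2)] ne by blast+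
    have "E \<inter> {Max ?P<..<Min ?Q} = {}"
    proof (safe)
      fix x assume "x \<in> E" "x \<in> {Max ?P<..<Min ?Q}"
      then show "x \<in> {}"
        using Max_ge[OF fin(1), of x] Min_le[OF fin(2), of x] by (cases "x \<le> z") auto
    qed
    then show thesis
      using P Q Max_ge[OF fin(1) ne(1)] Min_le[OF fin(2) ne(2)] by (intro that[of "Max ?P" "Min ?Q"]) auto
  next
    case False
    then have z: "z = e'" using assms by simp
    let ?P = "{x \<in> E. x < e'}"
    have fin: "finite ?P" using finite_E by auto
    have ne: "e \<in> ?P" using assms by auto
    have P: "Max ?P \<in> ?P" using Max_in[OF fin] ne by blast
    have "E \<inter> {Max ?P<..<e'} = {}"
    proof (safe)
      fix x assume "x \<in> E" "x \<in> {Max ?P<..<e'}"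
      then show "x \<in> {}" using Max_ge[OF fin, of x] by auto
    qed
    then show thesis
      using P Max_ge[OF fin ne] assms z by (intro that[of "Max ?P" e']) auto
  qed
  obtain j where "1 \<le> j" "j \<le> k" "box j = (p, q)" by (rule box_exists[OF pq(1-4)])
  then show thesis using pq(5-7) by (intro that[of j]) auto
qed

lemma k_pos: "1 \<le> k"
proof -
  obtain j where "1 \<le> j" "j \<le> k"
    using box_cover[of y b y] E_mem y_bounds by auto
  then show ?thesis by simp
qed

section \<open>Images of the pieces\<close>

definition last :: "nat \<Rightarrow> bool" where "last j \<longleftrightarrow> y' \<le> lo j"

definition piece :: "nat \<Rightarrow> real set" where "piece j = {lo j..hi j}"

lemma piece_props:
  assumes "1 \<le> j" "j \<le> k"
  shows "y \<le> lo j" "hi j \<le> b" "hi j \<le> c \<or> c \<le> lo j" "\<not> last j \<Longrightarrow> hi j \<le> y'"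
  using box_props[OF assms] E_sub E_mem by (auto simp: last_def)

lemma piece_in: "\<lbrakk>1 \<le> j; j \<le> k\<rbrakk> \<Longrightarrow> piece j \<subseteq> {a..b}"
  using piece_props[of j] y_bounds by (auto simp: piece_def)

lemma image_contains:
  assumes "1 \<le> j" "j \<le> k"
  shows "{min (g (lo j)) (g (hi j))..max (g (lo j)) (g (hi j))} \<subseteq> g ` piece j"
proof (rule connected_contains_Icc)
  have "continuous_on (piece j) g"
    using piece_in[OF assms] by (rule continuous_on_subset[OF cont])
  then show "connected (g ` piece j)"
    by (rule connected_continuous_image) (simp add: piece_def)
  have "lo j \<in> piece j" "hi j \<in> piece j"
    using box_props(3)[OF assms] by (auto simp: piece_def)
  then show "min (g (lo j)) (g (hi j)) \<in> g ` piece j" "max (g (lo j)) (g (hi j)) \<in> g ` piece j"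
    by (auto simp: min_def max_def)
qed

text \<open>A partition point strictly between \<open>y'\<close> and \<open>b\<close> would be
  mapped below \<open>g y' = y\<close>, hence out of \<open>E\<close>.\<close>

lemma last_piece:
  assumes "1 \<le> j" "j \<le> k" "last j"
  shows "lo j = y'" "hi j = b"
proof -
  have E_above: "e = b" if "e \<in> E" "y' < e" for e
  proof (rule ccontr)
    assume "e \<noteq> b"
    then have "g e \<in> E" using that E_inv[of e] y_bounds y' by auto
    then have "y \<le> g e" using E_sub by auto
    moreover have "g e < g y'" using dec[of y' e] that y' E_sub by auto
    ultimately show False using y' by simp
  qed
  note b = box_props[OF assms(1,2)] piece_props[OF assms(1,2)]
  show "hi j = b" using E_above[OF b(2)] b(3) assms(3) by (simp add: last_def)
  show "lo j = y'"
  proof (rule ccontr)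
    assume "lo j \<noteq> y'"
    then have "lo j = b" using E_above[OF b(1)] assms(3) by (simp add: last_def)
    then show False using b(3,6) by simp
  qed
qed

lemma last_image:
  assumes "1 \<le> j" "j \<le> k" "last j"
  shows "g ` piece j = {a..y}"
proof
  show "{a..y} \<subseteq> g ` piece j"
    using image_contains[OF assms(1,2)] last_piece[OF assms] y' y_bounds by simp
  show "g ` piece j \<subseteq> {a..y}"
    using dec_le[of y'] dec_le[of _ b] y' by (auto simp: piece_def last_piece[OF assms])
qed

text \<open>Since \<open>c\<close> is a partition point, such a piece lies left of \<open>c\<close>;
  its upper end is mapped into \<open>E\<close>, hence to at least \<open>y\<close>.\<close>

lemma first_image:
  assumes "1 \<le> j" "j \<le> k" "lo j = y"
  shows "{g y..y} \<subseteq> g ` piece j"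
proof -
  have "hi j \<le> c" using box_props(4)[OF assms(1,2), of c] E_mem y_bounds assms(3) by auto
  then have "g (hi j) \<in> E"
    using E_inv[of "hi j"] box_props[OF assms(1,2)] assms(3) cb by auto
  then have "y \<le> g (hi j)" using E_sub by auto
  then have "{g y..y} \<subseteq> {min (g (lo j)) (g (hi j))..max (g (lo j)) (g (hi j))}"
    using assms(3) by auto
  then show ?thesis using image_contains[OF assms(1,2)] by blast
qed

text \<open>The Markov property: the end points of such a piece are mapped into \<open>E\<close>,
  with the sole exception of \<open>y\<close>. The part of the image below \<open>y\<close> that
  this exception causes lies in the fundamental domain.\<close>

lemma image_cover:
  assumes j: "1 \<le> j" "j \<le> k" "\<not> last j" and z: "z \<in> g ` piece j"
  shows "(\<exists>i. 1 \<le> i \<and> i \<le> k \<and> z \<in> piece i \<and> piece i \<subseteq> g ` piece j) \<or>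
    lo j = y \<and> z \<in> {g y..y}"
proof -
  note b = box_props[OF j(1,2)] piece_props[OF j(1,2)]
  obtain x where x: "x \<in> {lo j..hi j}" "z = g x" using z by (auto simp: piece_def)
  have via: ?thesis if "e \<in> E" "e' \<in> E" "e < e'" "z \<in> {e..e'}"
    "min (g (lo j)) (g (hi j)) \<le> e" "e' \<le> max (g (lo j)) (g (hi j))" for e e'
  proof -
    note ee = that
    obtain i where i: "1 \<le> i" "i \<le> k" "z \<in> piece i" "e \<le> lo i" "hi i \<le> e'"
      using box_cover[OF ee(1-4)] unfolding piece_def by metis
    have "piece i \<subseteq> {min (g (lo j)) (g (hi j))..max (g (lo j)) (g (hi j))}"
      unfolding piece_def atLeastatMost_subset_iff using i(4,5) ee(5,6) by linarith
    then show ?thesis using i image_contains[OF j(1,2)] by blast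
  qed
  show ?thesis
  proof (cases "hi j \<le> c")
    case True
    have ghi: "g (hi j) \<in> E" using E_inv[of "hi j"] b True cb by auto
    have lt: "g (lo j) < g (hi j)" using inc[of "lo j" "hi j"] b True y_bounds by auto
    have zb: "g (lo j) \<le> z" "z \<le> g (hi j)"
      using inc_le[of "lo j" x] inc_le[of x "hi j"] x b True y_bounds by auto
    show ?thesis
    proof (cases "lo j = y")
      case lo: True
      show ?thesis
      proof (cases "z \<le> y")
        case False
        then show ?thesis
          using via[of y "g (hi j)"] E_mem ghi zb lo lt gy by auto
      qed (use lo zb in auto)
    next
      case False
      then have "g (lo j) \<in> E" using E_inv[of "lo j"] b True cb by auto
      then show ?thesis using via[of "g (lo j)" "g (hi j)"] ghi lt zb by auto
    qed
  next
    case False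
    then have clo: "c \<le> lo j" using b by blast
    have glo: "g (lo j) \<in> E" using E_inv[of "lo j"] b clo y_bounds by auto
    have ghi: "g (hi j) \<in> E"
    proof (cases "hi j = b")
      case True
      \<comment> \<open>As the piece is not the last one, it ends at or before \<open>y'\<close>. So
        \<open>b\<close> is mapped to \<open>g y' = y\<close>, a partition point.\<close>
      then have "y' = b" using b(8)[OF j(3)] y' by simp
      then show ?thesis using True y' E_mem by auto
    qed (use E_inv[of "hi j"] b in auto)
    have lt: "g (hi j) < g (lo j)" using dec[of "lo j" "hi j"] b clo by auto
    have zb: "g (hi j) \<le> z" "z \<le> g (lo j)"
      using dec_le[of "lo j" x] dec_le[of x "hi j"] x b clo by auto
    show ?thesis using via[of "g (hi j)" "g (lo j)"] glo ghi lt zb by auto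
  qed
qed

section \<open>Transitions between regions\<close>

text \<open>The image of the piece must contain the whole region entered. For the letter 0 this is
  \<open>[a, y]\<close> after the last piece and only \<open>[g y, y]\<close> after a piece starting
  at \<open>y\<close>.\<close>

definition allowed :: "nat \<Rightarrow> nat \<Rightarrow> bool" where
  "allowed j i \<longleftrightarrow> i \<le> k \<and>
    (if last j then i = 0 else if i = 0 then lo j = y else piece i \<subseteq> g ` piece j)"

text \<open>A forbidden proposal is replaced by a fixed allowed letter, so that every content of the
  input tape yields a path. The state 0 is absorbing.\<close>

definition successor :: "nat \<Rightarrow> nat \<Rightarrow> nat" where
  "successor j i = (if j = 0 then 0 else if allowed j i then i else (SOME i. allowed j i))"

lemma allowed_exists:
  assumes "1 \<le> j" "j \<le> k" "x \<in> piece j"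
  shows "\<exists>i. allowed j i \<and> (i \<noteq> 0 \<longrightarrow> g x \<in> piece i) \<and>
    (i = 0 \<longrightarrow> g x \<in> {a..y} \<and> (\<not> last j \<longrightarrow> g x \<in> {g y..y}))"
proof (cases "last j")
  case True
  then have "g x \<in> {a..y}" using last_image[OF assms(1,2)] assms(3) by blast
  then show ?thesis using True by (intro exI[of _ 0]) (simp add: allowed_def)
next
  case False
  then consider i where "1 \<le> i" "i \<le> k" "g x \<in> piece i" "piece i \<subseteq> g ` piece j"
    | "lo j = y" "g x \<in> {g y..y}"
    using image_cover[OF assms(1,2) False, of "g x"] assms(3) by blast
  then show ?thesis
  proof cases
    case 1
    then show ?thesis using False by (intro exI[of _ i]) (auto simp: allowed_def)
  next
    case 2
    then show ?thesis using False gy by (intro exI[of _ 0]) (auto simp: allowed_def)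
  qed
qed

lemma allowed_successor:
  assumes "1 \<le> j" "j \<le> k"
  shows "allowed j (successor j i)"
proof (cases "allowed j i")
  case False
  have "lo j \<in> piece j" using box_props(3)[OF assms] by (simp add: piece_def)
  then have "\<exists>i. allowed j i" using allowed_exists[OF assms] by blast
  then have "allowed j (SOME i. allowed j i)" by (rule someI_ex)
  then show ?thesis using False assms by (simp add: successor_def)
qed (use assms in \<open>simp add: successor_def\<close>)

lemma successor_le: "j \<le> k \<Longrightarrow> successor j i \<le> k"
  using allowed_successor[of j i] by (cases "j = 0") (auto simp: successor_def allowed_def)

section \<open>Coding the points near the left end point\<close>

definition \<delta> :: "(nat \<Rightarrow> nat) \<Rightarrow> real" where
  "\<delta> d = g y + (y - g y) * binary d"

lemma \<delta>_in: "\<delta> d \<in> {g y..y}"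
proof -
  have "(y - g y) * binary d \<le> (y - g y) * 1"
    using gy binary_range[of d] by (intro mult_left_mono) auto
  then show ?thesis using gy binary_range[of d] by (simp add: \<delta>_def)
qed

lemma \<delta>_onto:
  assumes "z \<in> {g y..y}"
  obtains d where "d \<in> seqs {..k}" "\<delta> d = z"
proof -
  have "\<exists>t. 0 \<le> t \<and> t \<le> 1 \<and> g y + (y - g y) * t = z"
  proof (cases "g y = y")
    case False
    then show ?thesis
      using assms gy by (intro exI[of _ "(z - g y) / (y - g y)"]) (auto simp: field_simps)
  qed (use assms in auto)
  then obtain t where t: "0 \<le> t" "t \<le> 1" "g y + (y - g y) * t = z" by blast
  obtain d where d: "\<And>i. d i \<le> (1::nat)" "binary d = t" using binary_onto[OF t(1,2)] by metis
  have "d i \<le> k" for i using d(1)[of i] k_pos by linarith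
  then show thesis using that[of d] d t by (auto simp: seqs_def \<delta>_def)
qed

text \<open>For the zero sequence the value is \<open>a\<close>, the limit of
  \<open>(g ^^ n) (\<delta> d)\<close>, as a closed graph requires.\<close>

definition \<theta> :: "(nat \<Rightarrow> nat) \<Rightarrow> (nat \<Rightarrow> nat) \<Rightarrow> real" where
  "\<theta> m d = (if \<exists>n. m n \<noteq> 0 then (g ^^ (LEAST n. m n \<noteq> 0)) (\<delta> d) else a)"

lemma \<theta>_eqI: "\<lbrakk>m n \<noteq> 0; \<And>i. i < n \<Longrightarrow> m i = 0\<rbrakk> \<Longrightarrow> \<theta> m d = (g ^^ n) (\<delta> d)"
proof -
  assume m: "m n \<noteq> 0" "\<And>i. i < n \<Longrightarrow> m i = 0"
  then have "(LEAST n. m n \<noteq> 0) = n"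
    by (intro Least_equality) (auto simp: not_less[symmetric])
  then show ?thesis using m(1) by (auto simp: \<theta>_def)
qed

lemma \<theta>_zeros: "(\<And>n. m n = 0) \<Longrightarrow> \<theta> m d = a"
  by (simp add: \<theta>_def)

lemma first_nonzero:
  fixes m :: "nat \<Rightarrow> nat"
  assumes "m n \<noteq> 0"
  obtains N where "m N \<noteq> 0" "\<And>i. i < N \<Longrightarrow> m i = 0"
  using that LeastI[of "\<lambda>n. m n \<noteq> 0" n] not_less_Least[of _ "\<lambda>n. m n \<noteq> 0"] assms by blast

lemma \<theta>_push0: "\<theta> (case_nat 0 m) d = g (\<theta> m d)"
proof (cases "\<exists>n. m n \<noteq> 0")
  case True
  then obtain N where N: "m N \<noteq> 0" "\<And>i. i < N \<Longrightarrow> m i = 0" by (metis first_nonzero)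
  have "\<theta> (case_nat 0 m) d = (g ^^ Suc N) (\<delta> d)"
    using N by (intro \<theta>_eqI) (auto split: nat.split)
  then show ?thesis using \<theta>_eqI[of m N d] N by simp
next
  case False
  then have "\<theta> m d = a" "\<theta> (case_nat 0 m) d = a"
    by (auto intro!: \<theta>_zeros split: nat.split)
  then show ?thesis by simp
qed

lemma \<theta>_push1: "\<theta> (case_nat (Suc 0) m) d = \<delta> d"
  using \<theta>_eqI[of "case_nat (Suc 0) m" 0 d] by simp

lemma it_mono_le_r:
  "\<lbrakk>a \<le> x; x \<le> z; z \<le> r\<rbrakk> \<Longrightarrow> (g ^^ n) x \<le> (g ^^ n) z"
proof (induction n)
  case (Suc n)
  then show ?case
    using inc_le[of "(g ^^ n) x" "(g ^^ n) z"] it_le_r[of x n] it_le_r[of z n] r_props by auto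
qed simp

lemma \<delta>_it: "a \<le> (g ^^ n) (\<delta> d)" "(g ^^ n) (\<delta> d) \<le> y"
  using it_le_r[of "\<delta> d" n] \<delta>_in[of d] gy y_bounds by auto

lemma \<theta>_in: "\<theta> m d \<in> {a..y}"
  using \<delta>_it y_bounds by (simp add: \<theta>_def)

text \<open>
  Each condition on the right depends on finitely many symbols of \<open>m\<close> only, so that it defines a
  closed set.
\<close>

lemma \<theta>_iff:
  "z = \<theta> m d \<longleftrightarrow> z \<in> {a..y} \<and> (\<forall>n. (\<forall>i<n. m i = 0) \<longrightarrow> z \<le> (g ^^ n) y) \<and>
     (\<forall>n. (\<forall>i<n. m i = 0) \<and> m n \<noteq> 0 \<longrightarrow> z = (g ^^ n) (\<delta> d))" (is "_ \<longleftrightarrow> ?R")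
proof (cases "\<exists>n. m n \<noteq> 0")
  case True
  then obtain N where N: "m N \<noteq> 0" "\<And>i. i < N \<Longrightarrow> m i = 0" by (metis first_nonzero)
  then have eq: "\<theta> m d = (g ^^ N) (\<delta> d)" by (rule \<theta>_eqI)
  have "(g ^^ N) (\<delta> d) \<le> (g ^^ n) y" if "\<forall>i<n. m i = 0" for n
  proof -
    have "n \<le> N" using that N(1) not_less by blast
    then have "(g ^^ N) (\<delta> d) = (g ^^ n) ((g ^^ (N - n)) (\<delta> d))"
      using it_add[of "N - n" n] by simp
    also have "\<dots> \<le> (g ^^ n) y"
      using \<delta>_it y_bounds by (intro it_mono_le_r) auto
    finally show ?thesis .
  qed
  moreover have "n = N" if "\<forall>i<n. m i = 0" "m n \<noteq> 0" for n
    using that N by (metis linorder_neqE_nat)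
  ultimately have "?R" if "z = (g ^^ N) (\<delta> d)"
    using \<delta>_it[of N d] that by (metis atLeastAtMost_iff)
  moreover have "z = (g ^^ N) (\<delta> d)" if ?R
    using that N by blast
  ultimately show ?thesis unfolding eq by blast
next
  case False
  then have eq: "\<theta> m d = a" by (auto intro: \<theta>_zeros)
  \<comment> \<open>If no nonzero symbol ever comes, only the upper bounds \<open>(g ^^ n) y\<close>
    remain, and they tend to \<open>a\<close>.\<close>
  have "z = a" if "z \<in> {a..y}" "\<And>n. z \<le> (g ^^ n) y"
    using y
  proof
    assume "a < y \<and> y < r"
    then have "z \<le> a"
      using LIMSEQ_le_const[OF basin_a[of y]] that(2) by auto
    then show ?thesis using that by simp
  qed (use that in auto)
  moreover have "a \<le> (g ^^ n) y" for n using it_in[of y n] y_bounds by auto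
  ultimately show ?thesis unfolding eq using False y_bounds by auto
qed

text \<open>If \<open>N = Suc n\<close> is the first time at which the orbit of \<open>y\<close>
  falls below \<open>z\<close>, then \<open>z\<close> lies between the images under
  \<open>g^n\<close> of \<open>g y\<close> and \<open>y\<close>, and the intermediate value theorem
  gives the point of the fundamental domain.\<close>

lemma \<theta>_onto:
  assumes "z \<in> {a..y}"
  obtains m d where "m \<in> seqs {..k}" "d \<in> seqs {..k}" "\<theta> m d = z"
proof (cases "z = a")
  case True
  then show thesis using that[of "\<lambda>_. 0" "\<lambda>_. 0"] by (auto simp: \<theta>_def seqs_def)
next
  case False
  then have ay: "a < z" "y < r" using assms y by auto
  have "\<exists>n. (g ^^ n) y < z"
    using order_tendstoD(2)[OF basin_a[of y] ay(1)] ay(2) y_bounds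
    by (auto simp: eventually_sequentially)
  define N where "N = (LEAST n. (g ^^ n) y < z)"
  have N: "(g ^^ N) y < z" "\<And>i. i < N \<Longrightarrow> z \<le> (g ^^ i) y"
    using LeastI_ex[OF \<open>\<exists>n. (g ^^ n) y < z\<close>] not_less_Least[of _ "\<lambda>n. (g ^^ n) y < z"]
    unfolding N_def by (blast intro: leI)+
  obtain n where n: "N = Suc n" using N(1) assms by (cases N) auto
  have "\<exists>d\<ge>g y. d \<le> y \<and> (g ^^ n) d = z"
  proof (rule IVT')
    show "(g ^^ n) (g y) \<le> z" using N(1) by (simp add: n funpow_swap1)
    show "z \<le> (g ^^ n) y" using N(2) n by simp
    show "continuous_on {g y..y} (g ^^ n)"
      using gy y_bounds by (intro continuous_on_subset[OF cont_it]) auto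
  qed (use gy in simp)
  then obtain x where x: "x \<in> {g y..y}" "(g ^^ n) x = z" by auto
  obtain d where d: "d \<in> seqs {..k}" "\<delta> d = x" using \<delta>_onto[OF x(1)] by metis
  let ?m = "\<lambda>i. if i < n then 0 else Suc 0"
  have "\<theta> ?m d = z" using \<theta>_eqI[of ?m n d] d x by simp
  moreover have "?m \<in> seqs {..k}" using k_pos by (auto simp: seqs_def)
  ultimately show thesis using that d by blast
qed

text \<open>
  Tape \<open>0\<close> holds the current piece, or \<open>0\<close> once the orbit has reached \<open>[a, y]\<close>; tape \<open>1\<close> proposes
  the next piece. On \<open>[a, y]\<close> tape \<open>3\<close> codes a point of the fundamental domain \<open>[g y, y]\<close> and
  the number of leading zeros of tape \<open>2\<close> counts the iterates applied to it. A piece starting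
  at \<open>y\<close> enters \<open>[a, y]\<close> through the fundamental domain, so that the counter is reset; the
  piece \<open>[y', b]\<close> is mapped onto \<open>[a, y]\<close> and leaves the counter as it is.
\<close>

definition tapes :: "nat set" where "tapes = {0, 1, 2, 3}"

definition alphabet :: "nat \<Rightarrow> nat set" where "alphabet = (\<lambda>_. {..k})"

definition transition :: "nat \<Rightarrow> (nat \<Rightarrow> nat) \<Rightarrow> nat action" where
  "transition t q =
     (if t = 0 then Push (successor (q 0) (q 1))
      else if t = 1 then Shift
      else if t = 2 then
        (if q 0 = 0 then Push 0
         else if successor (q 0) (q 1) = 0 \<and> \<not> last (q 0) then Push (Suc 0) else Stay)
      else Stay)"

lemma finite_automaton_transition: "finite_automaton tapes alphabet transition"
proof -
  have "successor (q 0) (q 1) \<le> k" if "q \<in> states tapes alphabet" for q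
    using that by (intro successor_le) (auto simp: states_def tapes_def alphabet_def PiE_iff)
  then show ?thesis
    using k_pos
    by (auto simp: finite_automaton_def automaton_def input_tape_def output_tape_def
        tapes_def alphabet_def transition_def)
qed

abbreviation "tape_space \<equiv> automaton_space tapes alphabet"
abbreviation "step \<equiv> automaton_map tapes transition"

lemma in_space_iff:
  "u \<in> topspace tape_space \<longleftrightarrow> u \<in> extensional tapes \<and> (\<forall>t\<in>tapes. u t \<in> seqs {..k})"
  by (auto simp: topspace_automaton_space alphabet_def PiE_iff)

lemma step_in_space: "u \<in> topspace tape_space \<Longrightarrow> step u \<in> topspace tape_space"
  using dynamical_system_automaton[of tapes alphabet transition] finite_automaton_transition
  by (auto simp: dynamical_system_def finite_automaton_def continuous_map_def)

lemma step_simps: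
  "step u 0 = case_nat (successor (u 0 0) (u 1 0)) (u 0)"
  "step u (Suc 0) = shift (u (Suc 0))"
  "step u 2 = (if u 0 0 = 0 then case_nat 0 (u 2)
     else if successor (u 0 0) (u 1 0) = 0 \<and> \<not> last (u 0 0) then case_nat (Suc 0) (u 2) else u 2)"
  "step u 3 = u 3"
  by (simp_all add: automaton_map_def tapes_def transition_def current_state_def)

section \<open>Tracking sets and the factor map\<close>

text \<open>Before entry into \<open>[a, y]\<close> only the current piece is recorded; from then on
  the tapes 2 and 3 determine the point itself.\<close>

definition \<Psi> :: "(nat \<Rightarrow> nat \<Rightarrow> nat) \<Rightarrow> real set" where
  "\<Psi> u = (if u 0 0 = 0 then {\<theta> (u 2) (u 3)} else piece (u 0 0))"

lemma state_le: "u \<in> topspace tape_space \<Longrightarrow> u 0 0 \<le> k"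
proof -
  assume "u \<in> topspace tape_space"
  moreover have "0 \<in> tapes" by (simp add: tapes_def)
  ultimately show ?thesis by (auto simp: in_space_iff seqs_def Pi_iff)
qed

text \<open>The last piece covers all of \<open>[a, y]\<close>, so any counter is admissible on
  leaving it. A piece starting at \<open>y\<close> is sure to cover only the fundamental domain, and
  the reset puts the new point there.\<close>

lemma \<Psi>_cover:
  assumes "u \<in> topspace tape_space"
  shows "\<Psi> (step u) \<subseteq> g ` \<Psi> u"
proof (cases "u 0 0 = 0")
  case True
  then show ?thesis by (simp add: \<Psi>_def step_simps successor_def \<theta>_push0)
next
  case False
  then have j: "1 \<le> u 0 0" "u 0 0 \<le> k" using state_le[OF assms] by auto
  have al: "allowed (u 0 0) (successor (u 0 0) (u 1 0))" by (rule allowed_successor[OF j])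
  show ?thesis
  proof (cases "last (u 0 0)")
    case True
    then have "successor (u 0 0) (u 1 0) = 0" using al by (simp add: allowed_def)
    then show ?thesis
      using False True last_image[OF j True] \<theta>_in[of "u 2" "u 3"]
      by (simp add: \<Psi>_def step_simps)
  next
    case nl: False
    show ?thesis
    proof (cases "successor (u 0 0) (u 1 0) = 0")
      case True
      then have "lo (u 0 0) = y" using al nl by (simp add: allowed_def)
      then show ?thesis
        using first_image[OF j] \<delta>_in[of "u 3"] False True nl
        by (auto simp: \<Psi>_def step_simps \<theta>_push1)
    next
      case nz: False
      then show ?thesis using al nl False by (simp add: \<Psi>_def step_simps allowed_def)
    qed
  qed
qed

text \<open>If the state 0 is reached, the candidate set is a singleton, but points following the
  same sides cannot be merged. Otherwise \<open>same_sides_le_r\<close> puts one of the two orbits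
  strictly below \<open>r\<close>, so that it is attracted to \<open>a\<close> and drops below
  \<open>y\<close>, where no piece lies.\<close>

lemma \<Psi>_unique:
  assumes u: "u \<in> topspace tape_space" and xz: "x \<in> {a..b}" "z \<in> {a..b}"
    and x: "\<And>n. (g ^^ n) x \<in> \<Psi> ((step ^^ n) u)" and z: "\<And>n. (g ^^ n) z \<in> \<Psi> ((step ^^ n) u)"
  shows "x = z"
proof (rule ccontr)
  assume "x \<noteq> z"
  define s where "s = (\<lambda>n. (step ^^ n) u 0 0)"
  define t where "t = (\<lambda>n. c \<le> lo (s n))"
  have uX: "(step ^^ n) u \<in> topspace tape_space" for n
    by (induction n) (use u step_in_space in auto)
  have s_le: "s n \<le> k" for n unfolding s_def by (rule state_le[OF uX])
  have in_piece: "(g ^^ n) x \<in> piece (s n)" "(g ^^ n) z \<in> piece (s n)" if "s n \<noteq> 0" for n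
    using x[of n] z[of n] that by (auto simp: \<Psi>_def s_def)
  have side: "side (t n) ((g ^^ n) x)" "side (t n) ((g ^^ n) z)" if "s n \<noteq> 0" for n
    using in_piece[OF that] piece_props(3)[of "s n"] s_le[of n] that
    by (auto simp: t_def side_def piece_def)
  have neq: "(g ^^ n) x \<noteq> (g ^^ n) z" if "\<And>i. i < n \<Longrightarrow> s i \<noteq> 0" for n
  proof -
    have "follows_upto n t x" "follows_upto n t z"
      using that side xz by (auto simp: follows_upto_def)
    then show ?thesis
      using follows_upto_order[of n t x z] follows_upto_order[of n t z x] \<open>x \<noteq> z\<close>
      by (metis less_irrefl linorder_neqE_linordered_idom)
  qed
  show False
  proof (cases "\<exists>n. s n = 0")
    case True
    define n where "n = (LEAST n. s n = 0)"
    have n: "s n = 0" unfolding n_def by (rule LeastI_ex[OF True])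
    have "s i \<noteq> 0" if "i < n" for i using not_less_Least that unfolding n_def by blast
    then have "(g ^^ n) x \<noteq> (g ^^ n) z" by (rule neq)
    then show False using x[of n] z[of n] n by (simp add: \<Psi>_def s_def)
  next
    case False
    then have nz: "\<And>n. s n \<noteq> 0" by simp
    have ge_y: "y \<le> (g ^^ n) x" "y \<le> (g ^^ n) z" for n
      using in_piece[OF nz[of n]] piece_props(1)[of "s n"] nz[of n] s_le[of n]
      by (auto simp: piece_def)
    have "follows t x" "follows t z" using side nz xz by (auto simp: follows_def)
    then obtain n where n: "(g ^^ n) x \<le> r" "(g ^^ n) z \<le> r"
      using same_sides_le_r \<open>x \<noteq> z\<close> by metis
    have nn: "(g ^^ n) x \<noteq> (g ^^ n) z" using neq nz by blast
    have leave: "\<not> (g ^^ n) w < r" if "w \<in> {a..b}" "\<And>i. y \<le> (g ^^ i) w" for w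
    proof
      assume lt: "(g ^^ n) w < r"
      then have "a < y" using y it_in[OF that(1), of n] by auto
      then have "\<exists>i. (g ^^ i) ((g ^^ n) w) < y"
        using order_tendstoD(2)[OF basin_a[OF _ lt], of y] it_in[OF that(1), of n]
        by (auto simp: eventually_sequentially)
      then show False using that(2) by (metis it_add not_less)
    qed
    show False
      using leave[OF xz(1) ge_y(1)] leave[OF xz(2) ge_y(2)] n nn by linarith
  qed
qed

text \<open>The pieces visited by the orbit are written in advance on the input tape. The tapes 2
  and 3 must be filled at time 0 so that they yield the right point at the later time of entry into
  \<open>[a, y]\<close>.\<close>

lemma \<Psi>_onto:
  assumes x: "x \<in> {a..b}"
  shows "\<exists>u\<in>topspace tape_space. \<forall>n. (g ^^ n) x \<in> \<Psi> ((step ^^ n) u)"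
proof -
  define good where "good = (\<lambda>n i. i \<le> k \<and> (if i = 0 then (g ^^ n) x \<in> {a..y} else (g ^^ n) x \<in> piece i))"
  \<comment> \<open>The relation \<open>allowed\<close> speaks of whole pieces; the extra clause
    says that the iterate of \<open>x\<close> itself enters through the fundamental domain.\<close>
  define link where "link = (\<lambda>n j i. if j = 0 then i = 0
      else allowed j i \<and> (i = 0 \<and> \<not> last j \<longrightarrow> (g ^^ Suc n) x \<in> {g y..y}))"
  have start: "\<exists>i. good 0 i"
  proof (cases "x \<le> y")
    case True
    then show ?thesis using x by (intro exI[of _ 0]) (auto simp: good_def)
  next
    case False
    then obtain j where "1 \<le> j" "j \<le> k" "x \<in> {lo j..hi j}"
      using box_cover[of y b x] E_mem y_bounds x by auto
    then show ?thesis by (intro exI[of _ j]) (auto simp: good_def piece_def)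
  qed
  have next_ex: "\<exists>i. good (Suc n) i \<and> link n j i" if "good n j" for n j
  proof (cases "j = 0")
    case True
    then have "(g ^^ n) x \<in> {a..y}" using that by (simp add: good_def)
    then have "g ((g ^^ n) x) \<in> {a..y}"
      using le_r_invariant[of "(g ^^ n) x"] y_bounds by auto
    then show ?thesis using True by (intro exI[of _ 0]) (simp add: good_def link_def)
  next
    case False
    then have "1 \<le> j" "j \<le> k" "(g ^^ n) x \<in> piece j" using that by (auto simp: good_def)
    from allowed_exists[OF this] obtain i where "allowed j i" "i \<noteq> 0 \<longrightarrow> g ((g ^^ n) x) \<in> piece i"
      "i = 0 \<longrightarrow> g ((g ^^ n) x) \<in> {a..y} \<and> (\<not> last j \<longrightarrow> g ((g ^^ n) x) \<in> {g y..y})"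
      by blast
    then show ?thesis using False by (intro exI[of _ i]) (auto simp: good_def link_def allowed_def)
  qed
  obtain S where S: "\<And>n. good n (S n)" "\<And>n. link n (S n) (S (Suc n))"
    using dependent_nat_choice[of good "\<lambda>n j i. link n j i"] start next_ex by metis
  have S_le: "S n \<le> k" for n using S(1)[of n] by (simp add: good_def)
  have S_succ: "successor (S n) (S (Suc n)) = S (Suc n)" for n
    using S(2)[of n] by (simp add: link_def successor_def split: if_splits)
  have S_zero: "S (n + i) = 0" if "S n = 0" for n i
  proof (induction i)
    case (Suc i)
    then show ?case using S(2)[of "n + i"] by (simp add: link_def)
  qed (use that in simp)
  obtain m d where md: "m \<in> seqs {..k}" "d \<in> seqs {..k}" "S 0 = 0 \<Longrightarrow> \<theta> m d = x"
    "\<And>n. \<lbrakk>S n \<noteq> 0; S (Suc n) = 0\<rbrakk> \<Longrightarrow>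
       \<theta> (if last (S n) then m else case_nat (Suc 0) m) d = (g ^^ Suc n) x"
  proof (cases "\<exists>n. S n = 0")
    case False
    then show thesis
      by (intro that[of "\<lambda>_. 0" "\<lambda>_. 0"]) (auto simp: seqs_def simp del: neq0_conv)
  next
    case True
    define N where "N = (LEAST n. S n = 0)"
    have N: "S N = 0" unfolding N_def by (rule LeastI_ex[OF True])
    have before: "S i \<noteq> 0" if "i < N" for i
      using not_less_Least that unfolding N_def by blast
    have zN: "(g ^^ N) x \<in> {a..y}" using S(1)[of N] N by (simp add: good_def)
    have N_eq: "Suc n = N" if "S n \<noteq> 0" "S (Suc n) = 0" for n
    proof -
      have "n < N"
      proof (rule ccontr)
        assume "\<not> n < N"
        then show False using S_zero[OF N, of "n - N"] that(1) by simp
      qed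
      moreover have "\<not> Suc n < N" using before[of "Suc n"] that(2) by blast
      ultimately show ?thesis by simp
    qed
    obtain m d where md: "m \<in> seqs {..k}" "d \<in> seqs {..k}" "\<theta> m d = (g ^^ N) x"
      by (rule \<theta>_onto[OF zN])
    show thesis
    \<comment> \<open>In the first case the counter is left alone until time \<open>N\<close>, so
      \<open>m\<close> and \<open>d\<close> must code the point of entry. In the second a nonzero
      symbol is pushed on entry, and only the tape \<open>d'\<close> counts.\<close>
    proof (cases "N = 0 \<or> last (S (N - 1))")
      case True
      show thesis
      proof (rule that[OF md(1,2)])
        show "\<theta> m d = x" if "S 0 = 0"
        proof -
          have "N = 0" using before[of 0] that by auto
          then show ?thesis using md(3) by simp
        qed
        fix n assume n: "S n \<noteq> 0" "S (Suc n) = 0"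
        then show "\<theta> (if last (S n) then m else case_nat (Suc 0) m) d = (g ^^ Suc n) x"
          using True md(3) N_eq[OF n] by auto
      qed
    next
      case False
      then obtain N' where N': "N = Suc N'" by (cases N) auto
      have "(g ^^ N) x \<in> {g y..y}"
        using S(2)[of N'] before[of N'] N False by (auto simp: link_def N')
      then obtain d' where d': "d' \<in> seqs {..k}" "\<delta> d' = (g ^^ N) x" by (rule \<delta>_onto)
      show thesis
      proof (rule that[OF md(1) d'(1)])
        show "\<theta> m d' = x" if "S 0 = 0" using before[of 0] that N' by auto
        fix n assume n: "S n \<noteq> 0" "S (Suc n) = 0"
        then show "\<theta> (if last (S n) then m else case_nat (Suc 0) m) d' = (g ^^ Suc n) x"
          using False d' N_eq[OF n] by (auto simp: \<theta>_push1)
      qed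
    qed
  qed
  define u where "u = (\<lambda>t\<in>tapes. if t = 0 then (\<lambda>_. S 0) else if t = 1 then (\<lambda>i. S (Suc i))
      else if t = 2 then m else d)"
  have u_space: "u \<in> topspace tape_space"
    unfolding in_space_iff using md(1,2) S_le by (auto simp: u_def seqs_def)
  \<comment> \<open>Tape 2 keeps its initial content until the entry; afterwards only the point it
    codes is followed.\<close>
  have inv: "(step ^^ n) u 0 0 = S n \<and> (step ^^ n) u 1 = (\<lambda>i. S (Suc (n + i))) \<and>
      (step ^^ n) u 3 = d \<and> (if S n = 0 then \<theta> ((step ^^ n) u 2) d = (g ^^ n) x else (step ^^ n) u 2 = m)"
    for n
  proof (induction n)
    case 0
    then show ?case using md(3) by (simp add: u_def tapes_def)
  next
    case (Suc n)
    have succ: "successor (S n) (S (Suc (n + 0))) = S (Suc n)" using S_succ[of n] by simp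
    show ?case
    proof (cases "S n = 0")
      case True
      then have "S (Suc n) = 0" using S_zero[of n 1] by simp
      then show ?thesis
        using Suc.IH succ True by (simp add: step_simps \<theta>_push0 shift_def)
    next
      case False
      show ?thesis
      proof (cases "S (Suc n) = 0")
        case True
        then show ?thesis
          using Suc.IH succ False md(4)[OF False True]
          by (auto simp: step_simps shift_def split: if_splits)
      next
        case nz: False
        then show ?thesis
          using Suc.IH succ False by (simp add: step_simps shift_def)
      qed
    qed
  qed
  have "(g ^^ n) x \<in> \<Psi> ((step ^^ n) u)" for n
    using inv[of n] S(1)[of n] by (auto simp: \<Psi>_def good_def split: if_splits)
  then show ?thesis using u_space by blast
qed

lemma openin_tape:
  "openin tape_space {u \<in> topspace tape_space. P (u 0 0)}"
  "openin tape_space {u \<in> topspace tape_space. \<forall>i<n. u 2 i = 0}"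
  "openin tape_space {u \<in> topspace tape_space. u 2 n \<noteq> 0}"
  by (rule openin_symbol openin_prefix, simp add: tapes_def)+

text \<open>By \<open>\<theta>_iff\<close> the relation is an intersection of implications whose
  premises are open conditions on finitely many symbols and whose conclusions are closed. In
  particular no continuity of \<open>\<theta>\<close> has to be shown beforehand.\<close>

lemma \<Psi>_closed:
  "closedin (prod_topology tape_space (top_of_set {a..b})) {(u, x). u \<in> topspace tape_space \<and> x \<in> \<Psi> u}"
proof -
  let ?Y = "top_of_set {a..b}"
  let ?P = "prod_topology tape_space ?Y"
  have snd: "continuous_map ?P euclideanreal snd"
    using continuous_map_snd[of tape_space ?Y] by (rule continuous_map_into_fulltopology)
  have icc: "closedin ?P {p \<in> topspace ?P. snd p \<in> {l..h}}" for l h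
    by (rule closedin_continuous_map_preimage[OF snd]) simp
  have le: "closedin ?P {p \<in> topspace ?P. snd p \<le> h}" for h
    using closedin_continuous_map_preimage[OF snd, of "{..h}"] by simp
  have eq: "closedin ?P {p \<in> topspace ?P. snd p = (g ^^ n) (\<delta> (fst p 3))}" for n
  proof -
    have "continuous_map tape_space euclideanreal (\<lambda>u. \<delta> (u 3))"
      unfolding \<delta>_def
      by (intro continuous_map_add continuous_map_real_mult continuous_map_binary)
        (auto simp: tapes_def)
    then have "continuous_map tape_space ?Y (\<lambda>u. \<delta> (u 3))"
      using order_trans[OF \<delta>_it(2)[of 0] less_imp_le[OF y_bounds(4)]] \<delta>_it(1)[of 0]
      by (auto simp: continuous_map_in_subtopology)
    moreover have "continuous_map ?Y euclideanreal (g ^^ n)"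
      using cont_it by simp
    ultimately have "continuous_map tape_space euclideanreal ((g ^^ n) \<circ> (\<lambda>u. \<delta> (u 3)))"
      by (rule continuous_map_compose)
    then have "continuous_map ?P euclideanreal (((g ^^ n) \<circ> (\<lambda>u. \<delta> (u 3))) \<circ> fst)"
      by (rule continuous_map_compose[OF continuous_map_fst])
    then have "continuous_map ?P euclideanreal (\<lambda>p. snd p - (g ^^ n) (\<delta> (fst p 3)))"
      using continuous_map_diff[OF snd] by (simp add: o_def)
    from closedin_continuous_map_preimage[OF this, of "{0}"] show ?thesis by simp
  qed
  have state: "openin tape_space {u \<in> topspace tape_space. Q u \<and> R u}"
    if "openin tape_space {u \<in> topspace tape_space. Q u}" "openin tape_space {u \<in> topspace tape_space. R u}" for Q R
    using openin_Int[OF that] by (rule back_subst[of "openin tape_space"]) auto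
  have "closedin ?P
    ((\<Inter>j\<in>{..k}. {p \<in> topspace ?P. fst p 0 0 \<noteq> 0 \<and> fst p 0 0 = j \<longrightarrow> snd p \<in> {lo j..hi j}}) \<inter>
     ({p \<in> topspace ?P. fst p 0 0 = 0 \<longrightarrow> snd p \<in> {a..y}} \<inter>
     ((\<Inter>n\<in>UNIV. {p \<in> topspace ?P. fst p 0 0 = 0 \<and> (\<forall>i<n. fst p 2 i = 0) \<longrightarrow> snd p \<le> (g ^^ n) y}) \<inter>
     (\<Inter>n\<in>UNIV. {p \<in> topspace ?P. fst p 0 0 = 0 \<and> (\<forall>i<n. fst p 2 i = 0) \<and> fst p 2 n \<noteq> 0 \<longrightarrow>
        snd p = (g ^^ n) (\<delta> (fst p 3))}))))"
    by (intro closedin_Int closedin_INT closedin_implies[where P = "\<lambda>u. u 0 0 \<noteq> 0 \<and> u 0 0 = _"]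
        closedin_implies[where P = "\<lambda>u. u 0 0 = 0"]
        closedin_implies[where P = "\<lambda>u. u 0 0 = 0 \<and> (\<forall>i<_. u 2 i = 0)"]
        closedin_implies[where P = "\<lambda>u. u 0 0 = 0 \<and> (\<forall>i<_. u 2 i = 0) \<and> u 2 _ \<noteq> 0"]
        state openin_tape icc le eq) auto
  also have "\<dots> = {(u, x). u \<in> topspace tape_space \<and> x \<in> \<Psi> u}" (is "?L = ?R")
  proof (intro set_eqI iffI)
    fix p assume p: "p \<in> ?L"
    then have t: "fst p \<in> topspace tape_space" by auto
    show "p \<in> ?R"
    proof (cases "fst p 0 0 = 0")
      case True
      then have "snd p = \<theta> (fst p 2) (fst p 3)" using p unfolding \<theta>_iff by auto
      then show ?thesis using t True by (auto simp: \<Psi>_def split: prod.splits)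
    next
      case False
      have "fst p 0 0 \<in> {..k}" using state_le[OF t] by simp
      then have "snd p \<in> piece (fst p 0 0)" using p False by (auto simp: piece_def)
      then show ?thesis using t False by (auto simp: \<Psi>_def split: prod.splits)
    qed
  next
    fix p assume p: "p \<in> ?R"
    then have t: "fst p \<in> topspace tape_space" and \<Psi>: "snd p \<in> \<Psi> (fst p)" by auto
    show "p \<in> ?L"
    proof (cases "fst p 0 0 = 0")
      case True
      then have e: "snd p = \<theta> (fst p 2) (fst p 3)" using \<Psi> by (simp add: \<Psi>_def)
      then have "snd p \<in> {a..b}" using \<theta>_in y_bounds by (auto intro: order_trans[of _ y])
      then show ?thesis using t True e[unfolded \<theta>_iff] by (auto simp: mem_Times_iff)
    next
      case False
      then have "snd p \<in> piece (fst p 0 0)" using \<Psi> by (simp add: \<Psi>_def)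
      moreover have "piece (fst p 0 0) \<subseteq> {a..b}"
        using piece_in state_le[OF t] False by simp
      ultimately show ?thesis using t False by (auto simp: mem_Times_iff piece_def)
    qed
  qed
  finally show ?thesis .
qed

lemma \<Psi>_nonempty: "u \<in> topspace tape_space \<Longrightarrow> \<Psi> u \<noteq> {}"
  using box_props(3)[of "u 0 0"] state_le[of u] by (auto simp: \<Psi>_def piece_def)

lemma is_factor_step: "is_factor (top_of_set {a..b}) g tape_space step"
proof (rule is_factor_by_tracking[where \<Psi> = \<Psi>])
  show "dynamical_system tape_space step"
    using finite_automaton_transition
    by (simp add: finite_automaton_def dynamical_system_automaton)
  show "g ` {a..b} \<subseteq> {a..b}" using g_in by blast
qed (use cont \<Psi>_closed \<Psi>_nonempty \<Psi>_cover \<Psi>_unique \<Psi>_onto in auto)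

end

theorem corollary1:
  fixes a b c :: real and g :: "real \<Rightarrow> real"
  assumes "S_unimodal a b g c"
    and "preperiodic (kneading g c)"
  shows "\<exists>(T :: nat set) (A :: nat \<Rightarrow> nat set) (F :: nat \<Rightarrow> (nat \<Rightarrow> nat) \<Rightarrow> nat action).
           finite_automaton T A F \<and>
           is_factor (top_of_set {a..b}) g (automaton_space T A) (automaton_map T F)"
proof -
  interpret expanding_unimodal a b c g
  proof
    show "unimodal a b g c" using assms(1) by (simp add: S_unimodal_def)
  qed (use S_unimodal_cross_ratio[OF assms(1)] assms(2) in auto)
  have "\<exists>E y y'. markov_partition a b c g E y y'"
  proof (rule partition_exists)
    fix E y y' assume "finite E" "E \<subseteq> {y..b}" "{y, c, y', b} \<subseteq> E"
      "a < y \<and> y < r \<or> y = a \<and> r = a" "c < y'" "y' \<le> b" "g y' = y"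
      "\<And>e. \<lbrakk>e \<in> E; e \<noteq> y; e \<noteq> b\<rbrakk> \<Longrightarrow> g e \<in> E"
    then have "markov_partition a b c g E y y'" by unfold_locales
    then show ?thesis by blast
  qed
  then obtain E y y' where "markov_partition a b c g E y y'" by blast
  then interpret markov_partition a b c g E y y' .
  show ?thesis using finite_automaton_transition is_factor_step by blast
qed

end
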